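(* Let $\Gamma\subset\mathbb R^N$ be a network with Hamiltonians $H_\gamma$ and a flux limiter $(c_x)_{x\in\mathbf V}$ as in the context. Given an arc $\gamma$ and an absolutely continuous curve $\eta:[a,b]\to[0,1]$ with $\eta(a)=\eta(b)$, one has $$\int_a^bL_\gamma(\eta,\dot\eta)\,d\tau\ \ge\ \int_a^b\bar L_\gamma(\eta,\dot\eta)\,d\tau\ \ge\ \big(c_{\gamma(0)}\wedge c_{\gamma(1)}\big)\,(b-a),$$ where $\bar L_\gamma(s,\lambda)=L_\gamma(s,\lambda)$ for $s\neq0,1$ and $\bar L_\gamma(s,\lambda)=L_\gamma(s,\lambda)+(c_{\gamma(0)}\wedge c_{\gamma(1)})-L_\gamma(s,0)$ for $s\in\{0,1\}$, and $\wedge$ denotes the minimum.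
   Context: Network. $\mathcal E$ is a finite collection of simple curves $\gamma:[0,1]\to\mathbb R^N$, called arcs, each $C^1$ up to the endpoints with nowhere vanishing derivative, and $\Gamma=\bigcup_{\gamma\in\mathcal E}\gamma([0,1])$. For each arc $\gamma$ the inverse arc $\widetilde\gamma(s)=\gamma(1-s)$ is also regarded as an arc. It is assumed that $\gamma((0,1))\cap\gamma'([0,1])=\emptyset$ whenever $\gamma\ne\gamma'$ and $\gamma\neq\widetilde{\gamma'}$. The set $\mathbf V$ of vertices is the set of initial and terminal points of arcs. $\Gamma$ is connected (any two vertices are linked by a finite concatenation of arcs) and there are no loops ($\gamma(0)\ne\gamma(1)$ for every arc). For $x\in\mathbf V$, $\Gamma_x=\{\gamma \text{ arc}: \gamma(1)=x\}$. Hamiltonians and Lagrangians. For each arc $\gamma$, $H_\gamma:[0,1]\times\mathbb R\to\mathbb R$ is continuous, convex in the second variable $\mu$, satisfies $\lim_{|\mu|\to\infty}\inf_{s\in[0,1]}H_\gamma(s,\mu)/|\mu|=+\infty$, and $H_{\widetilde\gamma}(s,\mu)=H_\gamma(1-s,-\mu)$. Set $L_\gamma(s,\lambda)=\max_{\mu\in\mathbb R}(\lambda\mu-H_\gamma(s,\mu))$ and $c_\gamma=-\max_{s\in[0,1]}\min_{\mu\in\mathbb R}H_\gamma(s,\mu)=\min_{s\in[0,1]}L_\gamma(s,0)$. A flux limiter is a function $x\mapsto c_x$ from $\mathbf V$ to $\mathbb R$ with $c_x\le\min_{\gamma\in\Gamma_x}c_\gamma$ for every $x\in\mathbf V$. 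*)

theory Defs
  imports "HOL-Analysis.Analysis"
begin

section \<open>Networks\<close>

text \<open>Differentiability is relative to the parameter interval, hence one-sided at its endpoints.\<close>

definition regular_curve :: "(real \<Rightarrow> 'a::real_normed_vector) \<Rightarrow> bool" where
  "regular_curve \<gamma> \<longleftrightarrow>
     (\<exists>\<gamma>'. continuous_on {0..1} \<gamma>' \<and>
        (\<forall>s\<in>{0..1}. (\<gamma> has_vector_derivative \<gamma>' s) (at s within {0..1}) \<and> \<gamma>' s \<noteq> 0))"

definition vertices :: "(real \<Rightarrow> 'a::topological_space) set \<Rightarrow> 'a set" where
  "vertices E = pathstart ` E \<union> pathfinish ` E"

definition arcs_into :: "(real \<Rightarrow> 'a::topological_space) set \<Rightarrow> 'a \<Rightarrow> (real \<Rightarrow> 'a) set" where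
  "arcs_into E x = {\<gamma> \<in> E. pathfinish \<gamma> = x}"

text \<open>
  The set \<open>E\<close> contains all arcs, the inverse ones included.  Arcs are functions on the whole
  real line of which only the values on the unit interval matter; by the disjointness
  assumption two members of \<open>E\<close> that agree on the unit interval are either equal as functions
  or inverse to each other, and the latter is excluded by simplicity.
\<close>

locale network =
  fixes E :: "(real \<Rightarrow> real ^ 'n) set"
  assumes finite_arcs: "finite E"
    and inverse_arc: "\<gamma> \<in> E \<Longrightarrow> reversepath \<gamma> \<in> E"
    and simple_arc: "\<gamma> \<in> E \<Longrightarrow> simple_path \<gamma>"
    and regular_arc: "\<gamma> \<in> E \<Longrightarrow> regular_curve \<gamma>"
    and no_loops: "\<gamma> \<in> E \<Longrightarrow> pathstart \<gamma> \<noteq> pathfinish \<gamma>"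
    and arcs_disjoint:
      "\<gamma> \<in> E \<Longrightarrow> \<gamma>' \<in> E \<Longrightarrow> \<gamma> \<noteq> \<gamma>' \<Longrightarrow> \<gamma> \<noteq> reversepath \<gamma>' \<Longrightarrow> \<gamma> ` {0<..<1} \<inter> path_image \<gamma>' = {}"
    and vertices_linked:
      "x \<in> vertices E \<Longrightarrow> y \<in> vertices E \<Longrightarrow> (x, y) \<in> {(pathstart \<gamma>, pathfinish \<gamma>) | \<gamma>. \<gamma> \<in> E}\<^sup>*"


section \<open>Hamiltonians, Lagrangians and flux limiters\<close>

locale network_hamiltonians = network E
  for E :: "(real \<Rightarrow> real ^ 'n) set" +
  fixes H :: "(real \<Rightarrow> real ^ 'n) \<Rightarrow> real \<Rightarrow> real \<Rightarrow> real"
  assumes H_continuous: "\<gamma> \<in> E \<Longrightarrow> continuous_on ({0..1} \<times> UNIV) (\<lambda>(s, \<mu>). H \<gamma> s \<mu>)"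
    and H_convex: "\<gamma> \<in> E \<Longrightarrow> s \<in> {0..1} \<Longrightarrow> convex_on UNIV (H \<gamma> s)"
    and H_superlinear:
      "\<gamma> \<in> E \<Longrightarrow> filterlim (\<lambda>\<mu>. INF s\<in>{0..1}. H \<gamma> s \<mu> / \<bar>\<mu>\<bar>) at_top at_infinity"
    and H_inverse: "\<gamma> \<in> E \<Longrightarrow> s \<in> {0..1} \<Longrightarrow> H (reversepath \<gamma>) s \<mu> = H \<gamma> (1 - s) (- \<mu>)"

text \<open>
  For a continuous superlinear Hamiltonian \<open>h\<close> and \<open>s\<close> in the unit interval, the suprema and
  infima in the next two definitions are attained, so they are maxima and minima.
\<close>

definition lagrangian :: "(real \<Rightarrow> real \<Rightarrow> real) \<Rightarrow> real \<Rightarrow> real \<Rightarrow> real" where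
  "lagrangian h s l = (SUP \<mu>. l * \<mu> - h s \<mu>)"

definition arc_constant :: "(real \<Rightarrow> real \<Rightarrow> real) \<Rightarrow> real" where
  "arc_constant h = - (SUP s\<in>{0..1}. INF \<mu>. h s \<mu>)"

locale flux_limited_network = network_hamiltonians E H
  for E :: "(real \<Rightarrow> real ^ 'n) set" and H +
  fixes c :: "real ^ 'n \<Rightarrow> real"
  assumes flux_limiter:
    "x \<in> vertices E \<Longrightarrow> c x \<le> Min ((\<lambda>\<gamma>. arc_constant (H \<gamma>)) ` arcs_into E x)"

definition modified_lagrangian ::
    "('a::topological_space \<Rightarrow> real) \<Rightarrow> (real \<Rightarrow> 'a) \<Rightarrow> (real \<Rightarrow> real \<Rightarrow> real) \<Rightarrow> real \<Rightarrow> real \<Rightarrow> real" where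
  "modified_lagrangian c \<gamma> h s l =
     (if s \<in> {0, 1}
      then lagrangian h s l + min (c (pathstart \<gamma>)) (c (pathfinish \<gamma>)) - lagrangian h s 0
      else lagrangian h s l)"


section \<open>Absolutely continuous curves and extended integrals\<close>

definition absolutely_continuous_curve :: "real \<Rightarrow> real \<Rightarrow> (real \<Rightarrow> real) \<Rightarrow> bool" where
  "absolutely_continuous_curve a b \<eta> \<longleftrightarrow>
     (\<forall>\<epsilon>>0. \<exists>\<delta>>0. \<forall>(n::nat) u v.
        (\<forall>i<n. a \<le> u i \<and> u i \<le> v i \<and> v i \<le> b) \<and>
        (\<forall>i<n. \<forall>j<n. i \<noteq> j \<longrightarrow> {u i<..<v i} \<inter> {u j<..<v j} = {}) \<and>
        (\<Sum>i<n. v i - u i) < \<delta> \<longrightarrow>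
        (\<Sum>i<n. \<bar>\<eta> (v i) - \<eta> (u i)\<bar>) < \<epsilon>)"

text \<open>
  An action integral is bounded below but may be infinite, whereas the Bochner integral of a
  non-integrable function is zero.  The following integral takes values in the extended reals;
  it is left unspecified for functions that are not measurable or whose positive and negative
  parts both have infinite integral, so that an inequality involving it carries the
  information that the integral exists.
\<close>

definition extended_integral :: "'a measure \<Rightarrow> ('a \<Rightarrow> real) \<Rightarrow> ereal" where
  "extended_integral M f =
     (if f \<in> borel_measurable M \<and>
         ((\<integral>\<^sup>+x. ennreal (f x) \<partial>M) < \<infinity> \<or> (\<integral>\<^sup>+x. ennreal (- f x) \<partial>M) < \<infinity>)
      then enn2ereal (\<integral>\<^sup>+x. ennreal (f x) \<partial>M) - enn2ereal (\<integral>\<^sup>+x. ennreal (- f x) \<partial>M)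
      else undefined)"

text \<open>
  The derivative of \<open>\<eta>\<close> exists almost everywhere when \<open>\<eta>\<close> is absolutely continuous; elsewhere
  \<^term>\<open>deriv \<eta>\<close> has irrelevant values.
\<close>

definition action :: "(real \<Rightarrow> real \<Rightarrow> real) \<Rightarrow> real \<Rightarrow> real \<Rightarrow> (real \<Rightarrow> real) \<Rightarrow> ereal" where
  "action \<Lambda> a b \<eta> = extended_integral (lebesgue_on {a..b}) (\<lambda>\<tau>. \<Lambda> (\<eta> \<tau>) (deriv \<eta> \<tau>))"

end

theory Submission
  imports Defs
begin

text \<open>
  Put \<open>m = min (c (\<gamma> 0)) (c (\<gamma> 1))\<close>.  As \<open>m\<close> is at most the arc constant, convexity and
  compactness give, for each \<open>e > 0\<close>, a continuous \<open>p\<close> with \<open>H \<gamma> s (p s) \<le> - m + e\<close> for all \<open>s\<close>,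
  and duality yields \<open>L (\<eta>, \<eta>') \<ge> p (\<eta>) \<eta>' + m - e\<close>.  For almost every time at which \<open>\<eta>\<close> is at an endpoint of
  the arc, \<open>\<eta>' = 0\<close> because \<open>\<eta>\<close> is extremal there, and the modified Lagrangian is then exactly \<open>m\<close>.
  If \<open>P' = p\<close>, the term \<open>p (\<eta>) \<eta>' = (P \<circ> \<eta>)'\<close> integrates to zero along the closed curve.
  The analytic input is that an absolutely continuous function is differentiable almost everywhere
  (Austin's proof for functions of bounded variation, via Vitali's covering theorem) and that it is the
  Henstock-Kurzweil integral of its derivative.
\<close>

section \<open>Functions of bounded variation\<close>

text \<open>The sublevel sets \<open>H \<gamma> s \<mu> \<le> - m\<close> may admit no continuous
  choice of \<open>\<mu>\<close>: the minimizers can jump as \<open>s\<close> varies. The slack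
  \<open>e\<close> turns them into strict sublevels, which persist under small changes of
  \<open>s\<close>, and convexity allows finitely many momenta to be averaged. Continuity of
  \<open>p\<close> makes \<open>P\<close> continuously differentiable, so the chain rule for
  \<open>P \<circ> \<eta>\<close> holds wherever \<open>\<eta>\<close> is differentiable and no
  exceptional set of positions has to be pulled back through \<open>\<eta>\<close>. At the endpoints
  of the arc the modified Lagrangian may lie below \<open>p (\<eta>) \<eta>' + m - e\<close> for
  nonzero velocities; this is why the velocity has to be shown to vanish there. The action can be
  infinite. As the modified Lagrangian is bounded below, its extended integral is either infinite,
  where the lower bound is trivial, or the integral of an integrable function. In the second case
  the comparison is one of Henstock-Kurzweil integrals, so \<open>p (\<eta>) \<eta>'\<close> only
  has to be integrable in that sense.\<close>

definition increment :: "(real \<Rightarrow> real) \<Rightarrow> real set \<Rightarrow> real" where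
  "increment g K = g (Sup K) - g (Inf K)"

lemma increment_interval [simp]: "u \<le> v \<Longrightarrow> increment g {u..v} = g v - g u"
  by (simp add: increment_def)

text \<open>Tagging each piece with its left endpoint turns the division into a tagged one, and
  increments telescope along tagged divisions of an interval.\<close>

lemma sum_increment_division:
  assumes "d division_of {s..t}" "s \<le> t"
  shows "(\<Sum>K\<in>d. increment g K) = g t - g s"
proof -
  have "(\<lambda>K. (Inf K, K)) ` d tagged_division_of {s..t}"
  proof (rule tagged_division_ofI)
    show "finite ((\<lambda>K. (Inf K, K)) ` d)"
      using assms by blast
    fix x K assume xK: "(x, K) \<in> (\<lambda>K. (Inf K, K)) ` d"
    then have "K \<in> d" and x: "x = Inf K" by auto
    then obtain u v where "K = cbox u v" "K \<noteq> {}"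
      using division_ofD[OF assms(1)] by metis
    then show "x \<in> K" "\<exists>u v. K = cbox u v"
      using x by auto
    show "K \<subseteq> {s..t}"
      using \<open>K \<in> d\<close> division_ofD[OF assms(1)] by blast
    fix x' K' assume "(x', K') \<in> (\<lambda>K. (Inf K, K)) ` d" "(x, K) \<noteq> (x', K')"
    then show "interior K \<inter> interior K' = {}"
      using xK division_ofD(5)[OF assms(1)] by auto
  next
    show "\<Union>{K. \<exists>x. (x, K) \<in> (\<lambda>K. (Inf K, K)) ` d} = {s..t}"
      using division_ofD(6)[OF assms(1)] by (auto simp: image_iff)
  qed
  from additive_tagged_division_1[OF assms(2) this, of g]
  show ?thesis
    by (subst (asm) sum.reindex) (auto simp: inj_on_def increment_def)
qed

section \<open>Outer measure bounds from Vitali covers\<close>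

lemma lmeasurable_Un_negligible:
  assumes "T \<in> lmeasurable" "negligible N"
  shows "T \<union> N \<in> lmeasurable" "measure lebesgue (T \<union> N) \<le> measure lebesgue T"
proof -
  have N: "N \<in> lmeasurable" "measure lebesgue N = 0"
    using assms(2) by (simp_all add: negligible_imp_measurable negligible_imp_measure0)
  show "T \<union> N \<in> lmeasurable"
    using assms(1) N(1) by (rule fmeasurable.Un)
  show "measure lebesgue (T \<union> N) \<le> measure lebesgue T"
    using measure_Un_le[of T lebesgue N] assms(1) N by (simp add: fmeasurableD)
qed

text \<open>\<open>S\<close> is not known to be measurable, so its size is expressed by a measurable
  superset. Vitali's theorem extracts from \<open>K\<close> countably many disjoint intervals
  covering \<open>S\<close> up to a null set; as \<open>bound\<close> controls every finite
  subfamily, it controls their union, and \<open>T\<close> is that union together with the uncovered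
  remainder.\<close>

lemma Vitali_interval_cover:
  fixes S :: "real set" and K :: "real set set"
  assumes K: "\<And>J. J \<in> K \<Longrightarrow> \<exists>u v. u < v \<and> J = {u..v}"
    and fine: "\<And>x d. x \<in> S \<Longrightarrow> 0 < d \<Longrightarrow> \<exists>J\<in>K. x \<in> J \<and> measure lborel J < d"
    and bound: "\<And>C. finite C \<Longrightarrow> C \<subseteq> K \<Longrightarrow> pairwise disjnt C \<Longrightarrow> (\<Sum>J\<in>C. measure lborel J) \<le> e"
  shows "\<exists>T. S \<subseteq> T \<and> T \<in> lmeasurable \<and> measure lebesgue T \<le> e"
proof -
  define mid rad :: "real set \<Rightarrow> real"
    where "mid J = (Inf J + Sup J) / 2" and "rad J = (Sup J - Inf J) / 2" for J
  have ball: "J = cball (mid J) (rad J)" "0 < rad J" "measure lborel J = 2 * rad J" if "J \<in> K" for J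
    using K[OF that] by (auto simp: mid_def rad_def cball_eq_atLeastAtMost field_simps)
  obtain C where C: "countable C" "C \<subseteq> K"
    "pairwise (\<lambda>i j. disjnt (cball (mid i) (rad i)) (cball (mid j) (rad j))) C"
    "negligible (S - (\<Union>i\<in>C. cball (mid i) (rad i)))"
  proof (rule Vitali_covering_theorem_cballs[of K rad S mid])
    show "\<exists>J. J \<in> K \<and> x \<in> cball (mid J) (rad J) \<and> rad J < d" if "x \<in> S" "0 < d" for x d
    proof -
      from fine[OF that] obtain J where J: "J \<in> K" "x \<in> J" "measure lborel J < d"
        by blast
      then have "x \<in> cball (mid J) (rad J)" "rad J < d"
        using ball[of J] by auto
      then show ?thesis using J by blast
    qed
  qed (use ball in auto)
  have eq: "(\<Union>i\<in>C. cball (mid i) (rad i)) = \<Union>C"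
  proof -
    have "cball (mid J) (rad J) = J" if "J \<in> C" for J
      using ball(1)[of J] C(2) that by auto
    then show ?thesis by simp
  qed
  have disj: "pairwise disjnt C"
    using C(2,3) ball unfolding pairwise_def by (metis subsetD)
  have meas: "J \<in> lmeasurable" "measure lebesgue J = measure lborel J" if "J \<in> C" for J
    using K C(2) that by (fastforce simp: subset_iff)+
  have le: "measure lebesgue (\<Union>F) \<le> e" if "F \<subseteq> C" "finite F" for F
  proof -
    have "measure lebesgue (\<Union>F) \<le> (\<Sum>J\<in>F. measure lebesgue J)"
      using that meas by (intro measure_Union_le) (auto simp: subset_iff fmeasurableD)
    also have "\<dots> = (\<Sum>J\<in>F. measure lborel J)"
      using meas that by (intro sum.cong) auto
    also have "\<dots> \<le> e"
      using that C disj by (intro bound) (auto intro: pairwise_subset)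
    finally show ?thesis .
  qed
  have UC: "\<Union>C \<in> lmeasurable" "measure lebesgue (\<Union>C) \<le> e"
    using fmeasurable_UN_bound[of C "\<lambda>J. J" lebesgue e] measure_UN_bound[of C "\<lambda>J. J" lebesgue e]
      C(1) meas(1) le by simp_all
  have "negligible (S - \<Union>C)" using C(4) eq by simp
  from lmeasurable_Un_negligible[OF UC(1) this] show ?thesis
    using UC(2) by (intro exI[of _ "\<Union>C \<union> (S - \<Union>C)"]) auto
qed

section \<open>Refinement of divisions\<close>

lemma division_of_UN:
  assumes d: "d division_of S" and q: "\<And>I. I \<in> d \<Longrightarrow> q I division_of I"
  shows "(\<Union>I\<in>d. q I) division_of S"
proof (rule division_ofI)
  note D = division_ofD[OF d] and Q = division_ofD[OF q]
  show "finite (\<Union>I\<in>d. q I)"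
    using D(1) Q(1) by blast
  show "\<Union>(\<Union>I\<in>d. q I) = S"
    using D(6) Q(6) by blast
  fix K assume "K \<in> (\<Union>I\<in>d. q I)"
  then obtain I where I: "I \<in> d" "K \<in> q I" by blast
  show "K \<subseteq> S"
    using Q(2)[OF I] D(2)[OF I(1)] by blast
  show "K \<noteq> {}" "\<exists>a b. K = cbox a b"
    using Q(3,4)[OF I] by simp_all
  fix K' assume "K' \<in> (\<Union>I\<in>d. q I)" and ne: "K \<noteq> K'"
  then obtain I' where I': "I' \<in> d" "K' \<in> q I'" by blast
  show "interior K \<inter> interior K' = {}"
  proof (cases "I = I'")
    case True
    then show ?thesis using Q(5)[OF I(1)] I I' ne by blast
  next
    case False
    then have "interior I \<inter> interior I' = {}"
      using D(5) I I' by blast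
    moreover have "interior K \<subseteq> interior I" "interior K' \<subseteq> interior I'"
      using interior_mono[OF Q(2)[OF I]] interior_mono[OF Q(2)[OF I']] by simp_all
    ultimately show ?thesis by blast
  qed
qed

lemma increment_degenerate:
  assumes "K = cbox u v" "K \<noteq> {}" "interior K = {}"
  shows "increment g K = 0"
  using assms by (auto simp: increment_def)

text \<open>Divisions of two different pieces can share only intervals with empty interior. Those
  are single points with increment 0; once they are discarded (\<open>q'\<close>), the families are
  disjoint and the double sum becomes a sum over the union.\<close>

lemma sum_abs_increment_refine:
  assumes d: "d division_of S" and q: "\<And>I. I \<in> d \<Longrightarrow> q I division_of I"
  shows "(\<Sum>I\<in>d. \<Sum>K\<in>q I. \<bar>increment g K\<bar>) \<le> (\<Sum>K\<in>(\<Union>I\<in>d. q I). \<bar>increment g K\<bar>)"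
proof -
  note D = division_ofD[OF d] and Q = division_ofD[OF q]
  define q' where "q' I = {K \<in> q I. interior K \<noteq> {}}" for I
  have fin: "finite (q' I)" if "I \<in> d" for I
    using Q(1)[OF that] by (simp add: q'_def)
  have "(\<Sum>I\<in>d. \<Sum>K\<in>q I. \<bar>increment g K\<bar>) = (\<Sum>I\<in>d. \<Sum>K\<in>q' I. \<bar>increment g K\<bar>)"
  proof (rule sum.cong[OF refl])
    fix I assume I: "I \<in> d"
    show "(\<Sum>K\<in>q I. \<bar>increment g K\<bar>) = (\<Sum>K\<in>q' I. \<bar>increment g K\<bar>)"
    proof (rule sum.mono_neutral_right)
      show "\<forall>K\<in>q I - q' I. \<bar>increment g K\<bar> = 0"
        using Q(3,4)[OF I] increment_degenerate by (metis (mono_tags, lifting) DiffE abs_zero mem_Collect_eq q'_def)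
    qed (use Q(1)[OF I] in \<open>auto simp: q'_def\<close>)
  qed
  also have "\<dots> = (\<Sum>K\<in>(\<Union>I\<in>d. q' I). \<bar>increment g K\<bar>)"
  proof (rule sum.UNION_disjoint[symmetric])
    show "finite d" "\<forall>I\<in>d. finite (q' I)"
      using D fin by auto
    show "\<forall>I\<in>d. \<forall>J\<in>d. I \<noteq> J \<longrightarrow> q' I \<inter> q' J = {}"
    proof (intro ballI impI, rule ccontr)
      fix I J assume IJ: "I \<in> d" "J \<in> d" "I \<noteq> J" and "q' I \<inter> q' J \<noteq> {}"
      then obtain K where K: "K \<in> q I" "K \<in> q J" "interior K \<noteq> {}"
        by (auto simp: q'_def)
      then have "interior K \<subseteq> interior I \<inter> interior J"
        using Q(2) IJ by (meson interior_mono le_inf_iff)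
      then show False
        using K D(5) IJ by blast
    qed
  qed
  also have "\<dots> \<le> (\<Sum>K\<in>(\<Union>I\<in>d. q I). \<bar>increment g K\<bar>)"
    using D(1) Q(1) by (intro sum_mono2) (auto simp: q'_def)
  finally show ?thesis .
qed

text \<open>
  Austin's argument: start from a division whose sum of absolute increments is within \<open>e\<close> of the
  total variation, and cover the points in question by disjoint intervals inside its pieces on
  which \<open>g\<close> moves against the increment of the piece.  Refining by such an interval raises
  the sum by at least twice its length, so these intervals have total length at most \<open>e / 2\<close>.
\<close>

lemma negligible_opposite_slopes:
  fixes g :: "real \<Rightarrow> real"
  assumes "s \<le> t"
    and bv: "\<And>d. d division_of {s..t} \<Longrightarrow> (\<Sum>K\<in>d. \<bar>increment g K\<bar>) \<le> B"
  shows "negligible {x \<in> {s<..<t}. (\<exists>\<^sub>F y in at x. (g y - g x) / (y - x) > 1) \<and>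
                                  (\<exists>\<^sub>F y in at x. (g y - g x) / (y - x) < -1)}" (is "negligible ?E")
  unfolding negligible_outer_le
proof (intro allI impI)
  fix e :: real assume "e > 0"
  define \<V> where "\<V> = (\<lambda>d. \<Sum>K\<in>d. \<bar>increment g K\<bar>) ` {d. d division_of {s..t}}"
  have "{{s..t}} division_of {s..t}"
    using division_of_self[of s t] assms(1) by simp
  then have "\<V> \<noteq> {}" by (auto simp: \<V>_def)
  have "bdd_above \<V>"
    using bv by (auto simp: \<V>_def intro!: bdd_aboveI)
  obtain d where d: "d division_of {s..t}" and dV: "Sup \<V> - e < (\<Sum>K\<in>d. \<bar>increment g K\<bar>)"
    using less_cSupD[OF \<open>\<V> \<noteq> {}\<close>, of "Sup \<V> - e"] \<open>e > 0\<close> by (auto simp: \<V>_def)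
  note D = division_ofD[OF d]
  define against :: "real set \<Rightarrow> real set \<Rightarrow> bool" where
    "against I J \<longleftrightarrow> (if increment g I \<ge> 0 then increment g J < - measure lborel J
                                           else increment g J > measure lborel J)" for I J
  \<comment> \<open>Asking for \<open>interior I\<close> rather than \<open>I\<close> makes
    \<open>I\<close> unique for each \<open>J\<close>, as division pieces have disjoint interiors;
    the endpoints lost in this way are finitely many and return as \<open>N\<close>.\<close>
  define K where "K = {J. (\<exists>u v. u < v \<and> J = {u..v}) \<and> (\<exists>I\<in>d. J \<subseteq> interior I \<and> against I J)}"
  let ?S = "?E \<inter> (\<Union>I\<in>d. interior I)"
  have "\<exists>T. ?S \<subseteq> T \<and> T \<in> lmeasurable \<and> measure lebesgue T \<le> e"
  proof (rule Vitali_interval_cover)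
    show "\<exists>u v. u < v \<and> J = {u..v}" if "J \<in> K" for J
      using that by (auto simp: K_def)
    show "\<exists>J\<in>K. x \<in> J \<and> measure lborel J < \<delta>" if x: "x \<in> ?S" and "0 < \<delta>" for x \<delta>
    proof -
      obtain I where I: "I \<in> d" "x \<in> interior I" using x by blast
      then obtain r where r: "r > 0" "ball x r \<subseteq> interior I"
        using open_contains_ball open_interior by blast
      \<comment> \<open>Slopes above 1 and below -1 both occur arbitrarily close to
        \<open>x\<close>, so whichever sign the increment of \<open>I\<close> has, the opposing
        slope is available.\<close>
      let ?Q = "\<lambda>y. if increment g I \<ge> 0 then (g y - g x) / (y - x) < -1 else (g y - g x) / (y - x) > 1"
      have "\<exists>\<^sub>F y in at x. ?Q y"
        using x by (cases "increment g I \<ge> 0") auto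
      then obtain y where y: "y \<noteq> x" "dist y x < min r \<delta>" "?Q y"
        using \<open>0 < \<delta>\<close> r(1) unfolding frequently_at by (metis min_less_iff_conj)
      define J where "J = {min x y..max x y}"
      have J: "increment g J = (g y - g x) / (y - x) * measure lborel J" "measure lborel J = \<bar>y - x\<bar>"
        using y(1) by (auto simp: J_def min_def max_def field_simps)
      have "measure lborel J > 0" using J y by auto
      have "against I J"
        using y(3) mult_strict_right_mono[OF _ \<open>measure lborel J > 0\<close>, of "(g y - g x) / (y - x)" "-1"]
          mult_strict_right_mono[OF _ \<open>measure lborel J > 0\<close>, of 1 "(g y - g x) / (y - x)"]
        unfolding against_def J(1) by (cases "0 \<le> increment g I") simp_all
      moreover have "J \<subseteq> interior I"
      proof -
        have "J \<subseteq> ball x r" using y by (auto simp: J_def dist_real_def)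
        then show ?thesis using r by blast
      qed
      ultimately have "J \<in> K"
        unfolding K_def using I y(1) J_def
        by (intro CollectI conjI exI[of _ "min x y"] exI[of _ "max x y"] bexI[of _ I]) (auto simp: min_def max_def)
      moreover have "x \<in> J" "measure lborel J < \<delta>"
        using y J by (auto simp: J_def dist_real_def)
      ultimately show ?thesis by blast
    qed
    show "(\<Sum>J\<in>C. measure lborel J) \<le> e" if C: "finite C" "C \<subseteq> K" "pairwise disjnt C" for C
    proof -
      define part where "part I = {J \<in> C. J \<subseteq> interior I}" for I
      have nonempty: "J \<noteq> {}" if "J \<in> C" for J
        using that C(2) by (auto simp: K_def)
      have "\<exists>q. part I \<subseteq> q \<and> q division_of I" if I: "I \<in> d" for I
      proof -
        have "part I division_of \<Union>(part I)"
        proof (rule division_ofI)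
          show "finite (part I)" using C(1) by (simp add: part_def)
          fix J assume J: "J \<in> part I"
          then show "J \<subseteq> \<Union>(part I)" "J \<noteq> {}" using nonempty by (auto simp: part_def)
          show "\<exists>a b. J = cbox a b"
            using J C(2) by (auto simp: part_def K_def)
          fix J' assume "J' \<in> part I" "J \<noteq> J'"
          then have "J \<inter> J' = {}"
            using C(3) J by (auto simp: part_def pairwise_def disjnt_def)
          then show "interior J \<inter> interior J' = {}"
            using interior_subset by blast
        qed auto
        moreover obtain u v where "I = cbox u v" "I \<noteq> {}"
          using D I by metis
        moreover have "\<Union>(part I) \<subseteq> I"
          using interior_subset by (auto simp: part_def)
        ultimately show ?thesis
          using partial_division_extend[of "part I" "\<Union>(part I)" "{I}" I] division_of_self[of u v] by metis
      qed
      then obtain q where q: "\<And>I. I \<in> d \<Longrightarrow> part I \<subseteq> q I" "\<And>I. I \<in> d \<Longrightarrow> q I division_of I"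
        by metis
      have ag: "against I J" if "I \<in> d" "J \<in> part I" for I J
      proof -
        obtain I' where I': "I' \<in> d" "J \<subseteq> interior I'" "against I' J"
          using \<open>J \<in> part I\<close> C(2) by (auto simp: part_def K_def)
        moreover have "J \<noteq> {}" "J \<subseteq> interior I"
          using \<open>J \<in> part I\<close> nonempty by (simp_all add: part_def)
        ultimately have "I = I'"
          using D(5)[OF \<open>I \<in> d\<close> I'(1)] by blast
        then show ?thesis using I' by simp
      qed
      \<comment> \<open>The factor 2: on an opposing \<open>J\<close> the term
        \<open>\<sigma> * increment g J\<close> is negative, so it falls short of
        \<open>\<bar>increment g J\<bar>\<close> by twice that absolute value, which exceeds twice
        the length of \<open>J\<close>.\<close>
      have key: "\<bar>increment g I\<bar> + 2 * (\<Sum>J\<in>part I. measure lborel J) \<le> (\<Sum>J\<in>q I. \<bar>increment g J\<bar>)" if I: "I \<in> d" for I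
      proof -
        obtain u v where uv: "I = {u..v}" "u \<le> v"
          using D(3,4)[OF I] by auto
        define \<sigma> :: real where "\<sigma> = (if increment g I \<ge> 0 then 1 else -1)"
        have fin: "finite (q I)" using q(2)[OF I] by blast
        have "\<bar>increment g I\<bar> = \<sigma> * (\<Sum>J\<in>q I. increment g J)"
          using sum_increment_division[of "q I" u v g] q(2)[OF I] uv by (simp add: \<sigma>_def)
        then have "\<bar>increment g I\<bar> + 2 * (\<Sum>J\<in>part I. measure lborel J) =
            (\<Sum>J\<in>q I. \<sigma> * increment g J + (if J \<in> part I then 2 * measure lborel J else 0))"
          using q(1)[OF I] fin
          by (simp add: sum.distrib sum_distrib_left sum.If_cases Int_absorb1 Int_absorb2)
        also have "\<dots> \<le> (\<Sum>J\<in>q I. \<bar>increment g J\<bar>)"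
        proof (rule sum_mono)
          fix J assume "J \<in> q I"
          show "\<sigma> * increment g J + (if J \<in> part I then 2 * measure lborel J else 0) \<le> \<bar>increment g J\<bar>"
            using ag[OF I, of J] by (auto simp: against_def \<sigma>_def split: if_splits)
        qed
        finally show ?thesis .
      qed
      have CU: "C = (\<Union>I\<in>d. part I)"
        using C(2) by (auto simp: part_def K_def)
      have "(\<Sum>J\<in>C. measure lborel J) = (\<Sum>I\<in>d. \<Sum>J\<in>part I. measure lborel J)"
        unfolding CU
      proof (rule sum.UNION_disjoint)
        show "finite d" "\<forall>I\<in>d. finite (part I)"
          using D C(1) by (auto simp: part_def)
        show "\<forall>I\<in>d. \<forall>I'\<in>d. I \<noteq> I' \<longrightarrow> part I \<inter> part I' = {}"
        proof (intro ballI impI, rule ccontr)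
          fix I I' assume I: "I \<in> d" "I' \<in> d" "I \<noteq> I'" and "part I \<inter> part I' \<noteq> {}"
          then obtain J where "J \<in> C" "J \<subseteq> interior I" "J \<subseteq> interior I'"
            by (auto simp: part_def)
          then show False
            using D(5)[OF I] nonempty by blast
        qed
      qed
      then have "(\<Sum>I\<in>d. \<bar>increment g I\<bar>) + 2 * (\<Sum>J\<in>C. measure lborel J) =
          (\<Sum>I\<in>d. \<bar>increment g I\<bar> + 2 * (\<Sum>J\<in>part I. measure lborel J))"
        by (simp add: sum.distrib sum_distrib_left)
      also have "\<dots> \<le> (\<Sum>I\<in>d. \<Sum>J\<in>q I. \<bar>increment g J\<bar>)"
        by (intro sum_mono key)
      also have "\<dots> \<le> (\<Sum>J\<in>(\<Union>I\<in>d. q I). \<bar>increment g J\<bar>)"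
        by (rule sum_abs_increment_refine[OF d q(2)])
      also have "\<dots> \<le> Sup \<V>"
        using division_of_UN[OF d q(2)] \<open>bdd_above \<V>\<close> by (intro cSup_upper) (auto simp: \<V>_def)
      finally have "2 * (\<Sum>J\<in>C. measure lborel J) < e"
        using dV by simp
      then show ?thesis using \<open>e > 0\<close> by linarith
    qed
  qed
  then obtain T where T: "?S \<subseteq> T" "T \<in> lmeasurable" "measure lebesgue T \<le> e" by blast
  define N where "N = (\<Union>I\<in>d. frontier I)"
  have N: "negligible N"
    unfolding N_def
  proof (intro negligible_Union)
    fix F assume "F \<in> frontier ` d"
    then show "negligible F"
      using D(4) negligible_convex_frontier convex_box(1) by (metis (no_types, lifting) imageE)
  qed (use D(1) in simp)
  have "?E \<subseteq> T \<union> N"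
  proof
    fix x assume x: "x \<in> ?E"
    then obtain I where I: "I \<in> d" "x \<in> I"
      using D(6) by (metis (no_types, lifting) UnionE atLeastAtMost_iff greaterThanLessThan_iff less_eq_real_def mem_Collect_eq)
    show "x \<in> T \<union> N"
    proof (cases "x \<in> interior I")
      case True
      then show ?thesis using x I T(1) by blast
    next
      case False
      then show ?thesis using I closure_subset by (auto simp: N_def frontier_def)
    qed
  qed
  with lmeasurable_Un_negligible[OF T(2) N] T(3)
  show "\<exists>T. ?E \<subseteq> T \<and> T \<in> lmeasurable \<and> measure lebesgue T \<le> e"
    by (intro exI[of _ "T \<union> N"]) auto
qed

text \<open>A Chebyshev-type estimate: disjoint intervals on which the slope exceeds
  \<open>k\<close> in absolute value are pieces of a division, so their increments sum to at most
  \<open>B\<close> and their lengths to at most \<open>B / k\<close>, for every positive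
  \<open>k\<close>.\<close>

lemma negligible_unbounded_slopes:
  fixes g :: "real \<Rightarrow> real"
  assumes "s \<le> t"
    and bv: "\<And>d. d division_of {s..t} \<Longrightarrow> (\<Sum>K\<in>d. \<bar>increment g K\<bar>) \<le> B"
  shows "negligible {x \<in> {s<..<t}. \<forall>k. \<exists>\<^sub>F y in at x. \<bar>(g y - g x) / (y - x)\<bar> > k}" (is "negligible ?E")
  unfolding negligible_outer_le
proof (intro allI impI)
  fix e :: real assume "e > 0"
  have "{{s..t}} division_of {s..t}"
    using division_of_self[of s t] assms(1) by simp
  from bv[OF this] have "B \<ge> 0" by simp
  \<comment> \<open>Chosen so that \<open>B / k < e\<close>; the added 1 keeps \<open>k\<close>
    positive when \<open>B = 0\<close>.\<close>
  define k where "k = (B + 1) / e"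
  have "k > 0" "B < k * e"
    using \<open>B \<ge> 0\<close> \<open>e > 0\<close> by (simp_all add: k_def)
  define K where "K = {J. (\<exists>u v. u < v \<and> J = {u..v}) \<and> J \<subseteq> {s<..<t} \<and> \<bar>increment g J\<bar> > k * measure lborel J}"
  show "\<exists>T. ?E \<subseteq> T \<and> T \<in> lmeasurable \<and> measure lebesgue T \<le> e"
  proof (rule Vitali_interval_cover)
    show "\<exists>u v. u < v \<and> J = {u..v}" if "J \<in> K" for J
      using that by (auto simp: K_def)
    show "\<exists>J\<in>K. x \<in> J \<and> measure lborel J < \<delta>" if x: "x \<in> ?E" and "0 < \<delta>" for x \<delta>
    proof -
      have "\<exists>\<^sub>F y in at x. \<bar>(g y - g x) / (y - x)\<bar> > k" "min (min (x - s) (t - x)) \<delta> > 0"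
        using x \<open>0 < \<delta>\<close> by auto
      then obtain y where y: "y \<noteq> x" "dist y x < min (min (x - s) (t - x)) \<delta>" "\<bar>(g y - g x) / (y - x)\<bar> > k"
        unfolding frequently_at by blast
      define J where "J = {min x y..max x y}"
      have J: "increment g J = (g y - g x) / (y - x) * measure lborel J" "measure lborel J = \<bar>y - x\<bar>"
        using y(1) by (auto simp: J_def min_def max_def field_simps)
      have "measure lborel J > 0" using J y by auto
      then have "\<bar>increment g J\<bar> > k * measure lborel J"
        using mult_strict_right_mono[OF y(3)] unfolding J(1) abs_mult by simp
      moreover have "J \<subseteq> {s<..<t}"
        using y x by (auto simp: J_def dist_real_def)
      ultimately have "J \<in> K"
        unfolding K_def using y(1) J_def
        by (intro CollectI conjI exI[of _ "min x y"] exI[of _ "max x y"]) (auto simp: min_def max_def)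
      moreover have "x \<in> J" "measure lborel J < \<delta>"
        using y J by (auto simp: J_def dist_real_def)
      ultimately show ?thesis by blast
    qed
    show "(\<Sum>J\<in>C. measure lborel J) \<le> e" if C: "finite C" "C \<subseteq> K" "pairwise disjnt C" for C
    proof -
      have "C division_of \<Union>C"
      proof (rule division_ofI)
        fix J assume J: "J \<in> C"
        then show "J \<subseteq> \<Union>C" by blast
        show "J \<noteq> {}" "\<exists>a b. J = cbox a b"
          using J C(2) by (auto simp: K_def)
        fix J' assume "J' \<in> C" "J \<noteq> J'"
        then have "J \<inter> J' = {}"
          using C(3) J by (auto simp: pairwise_def disjnt_def)
        then show "interior J \<inter> interior J' = {}"
          using interior_subset by blast
      qed (use C in auto)
      moreover have "\<Union>C \<subseteq> {s..t}"
        using C(2) by (force simp: K_def)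
      ultimately obtain q where q: "C \<subseteq> q" "q division_of {s..t}"
        using partial_division_extend \<open>{{s..t}} division_of {s..t}\<close> by metis
      have "k * (\<Sum>J\<in>C. measure lborel J) \<le> (\<Sum>J\<in>C. \<bar>increment g J\<bar>)"
        unfolding sum_distrib_left using C(2) by (intro sum_mono) (auto simp: K_def)
      also have "\<dots> \<le> (\<Sum>J\<in>q. \<bar>increment g J\<bar>)"
        using q by (intro sum_mono2) auto
      also have "\<dots> \<le> B" by (rule bv[OF q(2)])
      also have "\<dots> < k * e" by fact
      finally show ?thesis using \<open>k > 0\<close> by simp
    qed
  qed
qed

text \<open>Bounded difference quotients have finite lower and upper limits, and a common value of
  the two would be a derivative. The gap between them is marked by rationals so that only countably
  many cases arise.\<close>

lemma not_differentiable_cases: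
  fixes g :: "real \<Rightarrow> real" and x :: real
  defines "Q \<equiv> \<lambda>y. (g y - g x) / (y - x)"
  assumes "\<nexists>D. (g has_real_derivative D) (at x)"
    and "\<not> (\<forall>k. \<exists>\<^sub>F y in at x. \<bar>Q y\<bar> > k)"
  obtains p q :: rat where "p < q" "\<exists>\<^sub>F y in at x. Q y < of_rat p" "\<exists>\<^sub>F y in at x. Q y > of_rat q"
proof -
  obtain k where k: "\<forall>\<^sub>F y in at x. \<bar>Q y\<bar> \<le> k"
    using assms(3) by (auto simp: frequently_def not_less)
  let ?l = "Liminf (at x) (\<lambda>y. ereal (Q y))" and ?L = "Limsup (at x) (\<lambda>y. ereal (Q y))"
  have "?l \<le> ?L" by (rule Liminf_le_Limsup) simp
  have bnd: "ereal (-k) \<le> ?l" "?L \<le> ereal k"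
    using k by (auto intro!: Liminf_bounded Limsup_bounded elim!: eventually_mono)
  have "?l \<noteq> ?L"
  proof
    assume eq: "?l = ?L"
    have "\<exists>r. z = ereal r" if "ereal (-k) \<le> z" "z \<le> ereal k" for z
      using that by (cases z) auto
    then obtain r where r: "?l = ereal r"
      using bnd eq by metis
    have "((\<lambda>y. ereal (Q y)) \<longlongrightarrow> ereal r) (at x)"
      using r eq by (intro Liminf_eq_Limsup) auto
    then have "(Q \<longlongrightarrow> r) (at x)" by simp
    then show False
      using assms(2) by (auto simp: has_field_derivative_iff Q_def)
  qed
  with \<open>?l \<le> ?L\<close> have "?l < ?L" by simp
  then obtain r where r: "?l < ereal (of_rat r)" "ereal (of_rat r) < ?L"
    using ereal_dense3 by blast
  then obtain r' where r': "ereal (of_rat r) < ereal (of_rat r')" "ereal (of_rat r') < ?L"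
    using ereal_dense3 by blast
  show thesis
  proof
    show "r < r'" using r' by (simp add: of_rat_less)
    show "\<exists>\<^sub>F y in at x. Q y < of_rat r"
    proof (rule ccontr)
      assume "\<not> ?thesis"
      then have "\<forall>\<^sub>F y in at x. ereal (of_rat r) \<le> ereal (Q y)"
        by (simp add: frequently_def not_less)
      then show False using Liminf_bounded r(1) by (metis not_le)
    qed
    show "\<exists>\<^sub>F y in at x. Q y > of_rat r'"
    proof (rule ccontr)
      assume "\<not> ?thesis"
      then have "\<forall>\<^sub>F y in at x. ereal (Q y) \<le> ereal (of_rat r')"
        by (simp add: frequently_def not_less)
      then show False using Limsup_bounded r'(2) by (metis not_le)
    qed
  qed
qed

text \<open>A point of non-differentiability has unbounded quotients or two rationals separating its
  slopes. For each of the countably many pairs of rationals, an affine change reduces the second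
  kind to the slopes -1 and 1.\<close>

theorem bounded_variation_differentiable_ae:
  fixes g :: "real \<Rightarrow> real"
  assumes "s \<le> t"
    and bv: "\<And>d. d division_of {s..t} \<Longrightarrow> (\<Sum>K\<in>d. \<bar>increment g K\<bar>) \<le> B"
  shows "negligible {x \<in> {s<..<t}. \<nexists>D. (g has_real_derivative D) (at x)}"
proof -
  let ?Q = "\<lambda>x y. (g y - g x) / (y - x)"
  define E :: "rat \<times> rat \<Rightarrow> real set" where "E = (\<lambda>(p, q). if p < q then {x \<in> {s<..<t}.
      (\<exists>\<^sub>F y in at x. ?Q x y < of_rat p) \<and> (\<exists>\<^sub>F y in at x. ?Q x y > of_rat q)} else {})"
  have neg: "negligible (E (p, q))" for p q
  proof (cases "p < q")
    case True
    define P Q :: real where "P = of_rat p" and "Q = of_rat q"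
    have "P < Q" using True by (simp add: P_def Q_def of_rat_less)
    \<comment> \<open>Subtracting the line of slope \<open>(P + Q) / 2\<close> and scaling by
      \<open>2 / (Q - P)\<close> sends the slopes \<open>P\<close> and \<open>Q\<close> to -1 and
      1.\<close>
    define h where "h y = (2 * g y - (P + Q) * y) / (Q - P)" for y
    have slope: "(h y - h x) / (y - x) = (2 * ?Q x y - (P + Q)) / (Q - P)" if "y \<noteq> x" for x y
    proof -
      have "(h y - h x) / (y - x) = (2 * (g y - g x) - (P + Q) * (y - x)) / (y - x) / (Q - P)"
        by (simp add: h_def field_simps flip: diff_divide_distrib)
      also have "(2 * (g y - g x) - (P + Q) * (y - x)) / (y - x) = 2 * ?Q x y - (P + Q)"
        using that by (simp add: diff_divide_distrib)
      finally show ?thesis .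
    qed
    have "negligible {x \<in> {s<..<t}. (\<exists>\<^sub>F y in at x. (h y - h x) / (y - x) > 1) \<and>
                                  (\<exists>\<^sub>F y in at x. (h y - h x) / (y - x) < -1)}"
    proof (rule negligible_opposite_slopes[OF assms(1)])
      fix d assume d: "d division_of {s..t}"
      have "(\<Sum>K\<in>d. \<bar>increment h K\<bar>) \<le> (\<Sum>K\<in>d. \<bar>2 / (Q - P)\<bar> * \<bar>increment g K\<bar>
              + \<bar>(P + Q) / (Q - P)\<bar> * increment (\<lambda>x. x) K)"
      proof (rule sum_mono)
        fix K assume "K \<in> d"
        then obtain u v where uv: "K = {u..v}" "u \<le> v"
          using division_ofD(3,4)[OF d] by (metis atLeastatMost_empty_iff box_real(2))
        have "increment h K = 2 / (Q - P) * increment g K - (P + Q) / (Q - P) * (v - u)"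
          using uv by (simp add: h_def flip: diff_divide_distrib) (simp add: algebra_simps)
        also have "\<bar>\<dots>\<bar> \<le> \<bar>2 / (Q - P) * increment g K\<bar> + \<bar>(P + Q) / (Q - P) * (v - u)\<bar>"
          by (rule abs_triangle_ineq4)
        finally show "\<bar>increment h K\<bar> \<le> \<bar>2 / (Q - P)\<bar> * \<bar>increment g K\<bar>
              + \<bar>(P + Q) / (Q - P)\<bar> * increment (\<lambda>x. x) K"
          using uv by (simp only: abs_mult increment_interval)
      qed
      also have "\<dots> = \<bar>2 / (Q - P)\<bar> * (\<Sum>K\<in>d. \<bar>increment g K\<bar>) + \<bar>(P + Q) / (Q - P)\<bar> * (t - s)"
        unfolding sum.distrib sum_distrib_left[symmetric] sum_increment_division[OF d assms(1)] ..
      also have "\<dots> \<le> \<bar>2 / (Q - P)\<bar> * B + \<bar>(P + Q) / (Q - P)\<bar> * (t - s)"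
        by (intro add_right_mono mult_left_mono bv[OF d]) simp
      finally show "(\<Sum>K\<in>d. \<bar>increment h K\<bar>) \<le> \<bar>2 / (Q - P)\<bar> * B + \<bar>(P + Q) / (Q - P)\<bar> * (t - s)" .
    qed
    moreover have "E (p, q) \<subseteq> {x \<in> {s<..<t}. (\<exists>\<^sub>F y in at x. (h y - h x) / (y - x) > 1) \<and>
                                  (\<exists>\<^sub>F y in at x. (h y - h x) / (y - x) < -1)}"
    proof -
      have *: "(2 * z - (P + Q)) / (Q - P) > 1" if "z > Q" for z
        using that \<open>P < Q\<close> by (simp add: field_simps)
      have **: "(2 * z - (P + Q)) / (Q - P) < -1" if "z < P" for z
        using that \<open>P < Q\<close> by (simp add: field_simps)
      have "(h y - h x) / (y - x) > 1" if "y \<noteq> x" "?Q x y > Q" for x y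
        unfolding slope[OF that(1)] by (rule *[OF that(2)])
      moreover have "(h y - h x) / (y - x) < -1" if "y \<noteq> x" "?Q x y < P" for x y
        unfolding slope[OF that(1)] by (rule **[OF that(2)])
      ultimately show ?thesis
        unfolding E_def P_def[symmetric] Q_def[symmetric] split frequently_at if_P[OF True]
        by (intro Collect_mono) (meson)
    qed
    ultimately show ?thesis by (rule negligible_subset)
  qed (simp add: E_def)
  have "negligible ({x \<in> {s<..<t}. \<forall>k. \<exists>\<^sub>F y in at x. \<bar>?Q x y\<bar> > k} \<union> \<Union>(range E))"
    using neg by (intro negligible_Un negligible_unbounded_slopes[OF assms] negligible_countable_Union) auto
  moreover have "{x \<in> {s<..<t}. \<nexists>D. (g has_real_derivative D) (at x)}
      \<subseteq> {x \<in> {s<..<t}. \<forall>k. \<exists>\<^sub>F y in at x. \<bar>?Q x y\<bar> > k} \<union> \<Union>(range E)"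
  proof
    fix x assume x: "x \<in> {x \<in> {s<..<t}. \<nexists>D. (g has_real_derivative D) (at x)}"
    show "x \<in> {x \<in> {s<..<t}. \<forall>k. \<exists>\<^sub>F y in at x. \<bar>?Q x y\<bar> > k} \<union> \<Union>(range E)"
    proof (cases "\<forall>k. \<exists>\<^sub>F y in at x. \<bar>?Q x y\<bar> > k")
      case True
      then show ?thesis using x by auto
    next
      case False
      then obtain p q where "p < q" "\<exists>\<^sub>F y in at x. ?Q x y < of_rat p" "\<exists>\<^sub>F y in at x. ?Q x y > of_rat q"
        using not_differentiable_cases[of g x] x by auto
      then have "x \<in> E (p, q)" using x by (simp add: E_def)
      then show ?thesis by blast
    qed
  qed
  ultimately show ?thesis by (rule negligible_subset)
qed

section \<open>Absolutely continuous functions\<close>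

text \<open>The definition speaks of families indexed by initial segments of the naturals. Divisions
  supply families indexed by intervals or tagged intervals, so the condition is transferred along an
  enumeration of the index set.\<close>

lemma absolutely_continuous_curve_finite_family:
  assumes "absolutely_continuous_curve a b g" "e > 0"
  shows "\<exists>\<delta>>0. \<forall>(A :: 'i set) u v. finite A \<and> (\<forall>i\<in>A. a \<le> u i \<and> u i \<le> v i \<and> v i \<le> b) \<and>
       (\<forall>i\<in>A. \<forall>j\<in>A. i \<noteq> j \<longrightarrow> {u i<..<v i} \<inter> {u j<..<v j} = {}) \<and>
       (\<Sum>i\<in>A. v i - u i) < \<delta> \<longrightarrow> (\<Sum>i\<in>A. \<bar>g (v i) - g (u i)\<bar>) < e"
proof -
  obtain \<delta> where "\<delta> > 0" and \<delta>: "\<And>(n::nat) u v. (\<forall>i<n. a \<le> u i \<and> u i \<le> v i \<and> v i \<le> b) \<and>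
        (\<forall>i<n. \<forall>j<n. i \<noteq> j \<longrightarrow> {u i<..<v i} \<inter> {u j<..<v j} = {}) \<and>
        (\<Sum>i<n. v i - u i) < \<delta> \<longrightarrow> (\<Sum>i<n. \<bar>g (v i) - g (u i)\<bar>) < e"
    using assms(1)[unfolded absolutely_continuous_curve_def, rule_format, OF assms(2)] by (elim exE conjE) blast
  show ?thesis
  proof (intro exI[of _ \<delta>] conjI allI impI; (elim conjE)?)
    fix A :: "'i set" and u v
    assume A: "finite A" "\<forall>i\<in>A. a \<le> u i \<and> u i \<le> v i \<and> v i \<le> b"
       "\<forall>i\<in>A. \<forall>j\<in>A. i \<noteq> j \<longrightarrow> {u i<..<v i} \<inter> {u j<..<v j} = {}"
       "(\<Sum>i\<in>A. v i - u i) < \<delta>"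
    obtain h where h: "bij_betw h {..<card A} A"
      using A(1) by (metis ex_bij_betw_nat_finite atLeast0LessThan)
    have "(\<Sum>i<card A. \<bar>g (v (h i)) - g (u (h i))\<bar>) < e"
    proof (intro \<delta>[rule_format] conjI allI impI)
      have hA: "h i \<in> A" if "i < card A" for i
        using h that by (auto simp: bij_betw_def)
      show "(\<Sum>i<card A. v (h i) - u (h i)) < \<delta>"
        using A(4) sum.reindex_bij_betw[OF h, of "\<lambda>i. v i - u i"] by simp
      show "a \<le> u (h i)" "u (h i) \<le> v (h i)" "v (h i) \<le> b" if "i < card A" for i
        using A(2) hA[OF that] by simp_all
      fix i j assume ij: "i < card A" "j < card A" "i \<noteq> j"
      then have "h i \<noteq> h j"
        using h by (auto simp: bij_betw_def inj_on_def)
      then show "{u (h i)<..<v (h i)} \<inter> {u (h j)<..<v (h j)} = {}"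
        using A(3) hA ij by blast
    qed
    then show "(\<Sum>i\<in>A. \<bar>g (v i) - g (u i)\<bar>) < e"
      using sum.reindex_bij_betw[OF h, of "\<lambda>i. \<bar>g (v i) - g (u i)\<bar>"] by simp
  qed (rule \<open>\<delta> > 0\<close>)
qed

lemma division_interval_cases:
  fixes S :: "real set"
  assumes "d division_of S" "K \<in> d"
  obtains u v where "K = {u..v}" "u \<le> v"
  using division_ofD(3,4)[OF assms] by (metis atLeastatMost_empty_iff box_real(2))

text \<open>\<open>\<delta>\<close> is the one that absolute continuity gives for
  \<open>\<epsilon> = 1\<close>: the lengths in a division of \<open>{s..t}\<close> add up to
  \<open>t - s\<close>. A bound on short intervals is enough, since differentiability is
  local.\<close>

lemma absolutely_continuous_imp_bounded_variation:
  assumes ac: "absolutely_continuous_curve a b g"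
  shows "\<exists>\<delta>>0. \<forall>s t d. a \<le> s \<and> s \<le> t \<and> t \<le> b \<and> t - s < \<delta> \<and> d division_of {s..t} \<longrightarrow>
       (\<Sum>K\<in>d. \<bar>increment g K\<bar>) \<le> 1"
proof -
  obtain \<delta> where "\<delta> > 0" and \<delta>: "\<forall>(A :: real set set) u v. finite A \<and>
       (\<forall>i\<in>A. a \<le> u i \<and> u i \<le> v i \<and> v i \<le> b) \<and>
       (\<forall>i\<in>A. \<forall>j\<in>A. i \<noteq> j \<longrightarrow> {u i<..<v i} \<inter> {u j<..<v j} = {}) \<and>
       (\<Sum>i\<in>A. v i - u i) < \<delta> \<longrightarrow> (\<Sum>i\<in>A. \<bar>g (v i) - g (u i)\<bar>) < 1"
      using absolutely_continuous_curve_finite_family[OF ac zero_less_one] by blast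
  show ?thesis
  proof (intro exI[of _ \<delta>] conjI allI impI; (elim conjE)?)
    fix s t d assume st: "a \<le> s" "s \<le> t" "t \<le> b" "t - s < \<delta>" and d: "d division_of {s..t}"
    have "(\<Sum>K\<in>d. \<bar>g (Sup K) - g (Inf K)\<bar>) < 1"
    proof (intro \<delta>[rule_format] conjI ballI impI)
      show "finite d" using d by blast
      show "a \<le> Inf K" "Inf K \<le> Sup K" "Sup K \<le> b" if "K \<in> d" for K
      proof -
        from division_interval_cases[OF d that] obtain u v where K: "K = {u..v}" "u \<le> v" .
        moreover have "K \<subseteq> {s..t}" using division_ofD(2)[OF d that] .
        ultimately show "a \<le> Inf K" "Inf K \<le> Sup K" "Sup K \<le> b" using st by auto
      qed
      show "{Inf K<..<Sup K} \<inter> {Inf K'<..<Sup K'} = {}" if K: "K \<in> d" "K' \<in> d" "K \<noteq> K'" for K K'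
      proof -
        obtain u v where uv: "K = {u..v}" "u \<le> v" using division_interval_cases[OF d K(1)] .
        obtain u' v' where uv': "K' = {u'..v'}" "u' \<le> v'" using division_interval_cases[OF d K(2)] .
        show ?thesis using division_ofD(5)[OF d K] uv uv' by simp
      qed
      show "(\<Sum>K\<in>d. Sup K - Inf K) < \<delta>"
        using sum_increment_division[OF d st(2), of "\<lambda>x. x"] st(4) by (simp add: increment_def)
    qed
    then show "(\<Sum>K\<in>d. \<bar>increment g K\<bar>) \<le> 1"
      by (simp add: increment_def)
  qed (rule \<open>\<delta> > 0\<close>)
qed

text \<open>Every point of the open interval lies inside an interval with rational endpoints and
  length below \<open>\<delta>\<close>, where the variation is at most 1; there are countably many
  such intervals.\<close>

theorem absolutely_continuous_differentiable_ae:
  assumes ac: "absolutely_continuous_curve a b g"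
  shows "negligible {x \<in> {a<..<b}. \<nexists>D. (g has_real_derivative D) (at x)}"
proof -
  obtain \<delta> where "\<delta> > 0" and bv: "\<forall>s t d. a \<le> s \<and> s \<le> t \<and> t \<le> b \<and> t - s < \<delta> \<and>
       d division_of {s..t} \<longrightarrow> (\<Sum>K\<in>d. \<bar>increment g K\<bar>) \<le> 1"
    using absolutely_continuous_imp_bounded_variation[OF ac] by blast
  define E :: "rat \<times> rat \<Rightarrow> real set" where
    "E = (\<lambda>(p, q). if a \<le> of_rat p \<and> (of_rat p :: real) \<le> of_rat q \<and> of_rat q \<le> b \<and> of_rat q - of_rat p < \<delta>
       then {x \<in> {of_rat p<..<of_rat q}. \<nexists>D. (g has_real_derivative D) (at x)} else {})"
  have "negligible (E (p, q))" for p q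
  proof (cases "a \<le> of_rat p \<and> (of_rat p :: real) \<le> of_rat q \<and> of_rat q \<le> b \<and> of_rat q - of_rat p < \<delta>")
    case True
    then show ?thesis
      unfolding E_def split if_P[OF True]
      by (intro bounded_variation_differentiable_ae[where B = 1] bv[rule_format] conjI) simp_all
  qed (auto simp: E_def)
  then have "negligible (\<Union>(range E))"
    by (intro negligible_countable_Union) auto
  moreover have "{x \<in> {a<..<b}. \<nexists>D. (g has_real_derivative D) (at x)} \<subseteq> \<Union>(range E)"
  proof
    fix x assume x: "x \<in> {x \<in> {a<..<b}. \<nexists>D. (g has_real_derivative D) (at x)}"
    obtain p where p: "max a (x - \<delta> / 2) < of_rat p" "of_rat p < x"
      using of_rat_dense[of "max a (x - \<delta> / 2)" x] x \<open>\<delta> > 0\<close> by auto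
    obtain q where q: "x < of_rat q" "of_rat q < min b (x + \<delta> / 2)"
      using of_rat_dense[of x "min b (x + \<delta> / 2)"] x \<open>\<delta> > 0\<close> by auto
    have "x \<in> E (p, q)"
      using x p q by (auto simp: E_def)
    then show "x \<in> \<Union>(range E)" by blast
  qed
  ultimately show ?thesis by (rule negligible_subset)
qed

section \<open>The fundamental theorem of calculus for absolutely continuous functions\<close>

lemma straddle_bound:
  fixes g :: "real \<Rightarrow> real"
  assumes "\<And>y. y \<in> {u, v} \<Longrightarrow> \<bar>g y - g x - D * (y - x)\<bar> \<le> c * \<bar>y - x\<bar>" "u \<le> x" "x \<le> v"
  shows "\<bar>(v - u) * D - (g v - g u)\<bar> \<le> c * (v - u)"
proof -
  \<comment> \<open>The straddle lemma of gauge integration: as \<open>x\<close> lies between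
    \<open>u\<close> and \<open>v\<close>, the distances to the two ends, and with them the errors
    of the linear approximation, add up to no more than \<open>v - u\<close> allows.\<close>
  have "\<bar>(v - u) * D - (g v - g u)\<bar> = \<bar>(g u - g x - D * (u - x)) - (g v - g x - D * (v - x))\<bar>"
    by (simp add: algebra_simps)
  also have "\<dots> \<le> c * \<bar>u - x\<bar> + c * \<bar>v - x\<bar>"
    by (rule order_trans[OF abs_triangle_ineq4]) (intro add_mono assms(1); simp)
  also have "\<dots> = c * (v - u)"
    using assms(2,3) by (simp add: algebra_simps)
  finally show ?thesis .
qed

theorem absolutely_continuous_fundamental_theorem:
  fixes g :: "real \<Rightarrow> real"
  assumes "a \<le> b" and ac: "absolutely_continuous_curve a b g"
    and N: "negligible N"
    and deriv: "\<And>x. x \<in> {a..b} - N \<Longrightarrow> (g has_real_derivative g' x) (at x within {a..b})"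
  shows "(g' has_integral (g b - g a)) {a..b}"
proof -
  txt \<open>
    The gauge confines the division pieces tagged in \<open>N\<close> to an open set \<open>U\<close> of small measure,
    where absolute continuity makes the increments of \<open>g\<close> small.
  \<close>
  define f where "f x = (if x \<in> N then 0 else g' x)" for x
  have "(f has_integral (g b - g a)) (cbox a b)"
    unfolding has_integral
  proof (intro allI impI)
    fix e :: real assume "e > 0"
    \<comment> \<open>The pieces tagged outside \<open>N\<close> have total error at most
      \<open>c * (b - a)\<close>; the added 1 in the denominator covers
      \<open>a = b\<close>.\<close>
    define c where "c = e / (2 * (b - a + 1))"
    have "c > 0" "c * (b - a) < e / 2"
      using \<open>a \<le> b\<close> \<open>e > 0\<close> by (simp_all add: c_def field_simps)
    obtain \<delta> where "\<delta> > 0" and \<delta>: "\<forall>(A :: (real \<times> real set) set) u v. finite A \<and>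
       (\<forall>i\<in>A. a \<le> u i \<and> u i \<le> v i \<and> v i \<le> b) \<and>
       (\<forall>i\<in>A. \<forall>j\<in>A. i \<noteq> j \<longrightarrow> {u i<..<v i} \<inter> {u j<..<v j} = {}) \<and>
       (\<Sum>i\<in>A. v i - u i) < \<delta> \<longrightarrow> (\<Sum>i\<in>A. \<bar>g (v i) - g (u i)\<bar>) < e / 2"
      using absolutely_continuous_curve_finite_family[OF ac half_gt_zero[OF \<open>e > 0\<close>]] by blast
    obtain U where U: "open U" "N \<subseteq> U" "emeasure lebesgue U < ennreal \<delta>"
    proof -
      have "N \<in> sets lebesgue" "emeasure lebesgue N = 0"
        using N by (auto simp: negligible_iff_null_sets)
      then obtain U where U: "open U" "N \<subseteq> U" "emeasure lebesgue (U - N) < ennreal \<delta>"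
        using sets_lebesgue_outer_open[of N \<delta>] \<open>\<delta> > 0\<close> by metis
      have "U - N \<in> sets lebesgue"
        using U(1) \<open>N \<in> sets lebesgue\<close> by (intro sets.Diff) auto
      moreover have "U - N \<union> N = U" using U(2) by blast
      ultimately have "emeasure lebesgue U \<le> emeasure lebesgue (U - N) + emeasure lebesgue N"
        using emeasure_subadditive[of "U - N" lebesgue N] \<open>N \<in> sets lebesgue\<close> by metis
      then show thesis
        using that U \<open>emeasure lebesgue N = 0\<close> by simp
    qed
    have "\<exists>r>0. \<forall>y\<in>{a..b}. \<bar>y - x\<bar> < r \<longrightarrow> \<bar>g y - g x - f x * (y - x)\<bar> \<le> c * \<bar>y - x\<bar>"
      if "x \<in> {a..b} - N" for x
      using deriv[OF that] that \<open>c > 0\<close>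
      unfolding has_field_derivative_def has_derivative_within_alt f_def by auto
    then obtain r where r: "\<And>x. x \<in> {a..b} - N \<Longrightarrow> r x > 0"
      "\<And>x y. x \<in> {a..b} - N \<Longrightarrow> y \<in> {a..b} \<Longrightarrow> \<bar>y - x\<bar> < r x \<Longrightarrow> \<bar>g y - g x - f x * (y - x)\<bar> \<le> c * \<bar>y - x\<bar>"
      by metis
    define G where "G x = (if x \<in> N then U else if x \<in> {a..b} then ball x (r x) else UNIV)" for x
    have "gauge G"
      unfolding gauge_def G_def using U r(1) by auto
    moreover have "norm ((\<Sum>(x, K)\<in>p. measure lborel K *\<^sub>R f x) - (g b - g a)) < e"
      if "p tagged_division_of cbox a b \<and> G fine p" for p
    proof -
      have p: "p tagged_division_of cbox a b" "G fine p" using that by simp_all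
      note P = tagged_division_ofD[OF p(1)]
      have ival: "\<exists>u v. K = {u..v} \<and> u \<le> x \<and> x \<le> v \<and> a \<le> u \<and> v \<le> b \<and> K \<subseteq> G x" if "(x, K) \<in> p" for x K
      proof -
        from P(4)[OF that] obtain u v where "K = {u..v}" by auto
        moreover have "x \<in> K" "K \<subseteq> {a..b}" "K \<subseteq> G x"
          using P(2,3)[OF that] p(2) that by (auto simp: fine_def)
        ultimately show ?thesis by (intro exI[of _ u] exI[of _ v]) auto
      qed
      define p1 where "p1 = {xK \<in> p. fst xK \<in> N}"
      define err where "err = (\<lambda>(x, K). measure lborel K * f x - increment g K)"
      have fin: "finite p" "finite p1" "p1 \<subseteq> p" using P(1) by (auto simp: p1_def)
      have "(\<Sum>(x, K)\<in>p. measure lborel K *\<^sub>R f x) - (g b - g a) = sum err p"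
        using additive_tagged_division_1[OF \<open>a \<le> b\<close>, of p g] p(1)
        by (simp add: err_def case_prod_unfold sum_subtractf increment_def)
      also have "\<dots> = sum err p1 + sum err (p - p1)"
        using fin by (simp add: sum.subset_diff add.commute)
      finally have split: "(\<Sum>(x, K)\<in>p. measure lborel K *\<^sub>R f x) - (g b - g a) = sum err p1 + sum err (p - p1)" .
      have "\<bar>sum err (p - p1)\<bar> \<le> (\<Sum>xK\<in>p - p1. c * measure lborel (snd xK))"
      proof (rule order_trans[OF sum_abs sum_mono])
        fix xK assume "xK \<in> p - p1"
        then obtain x K where xK: "xK = (x, K)" "(x, K) \<in> p" "x \<notin> N"
          by (cases xK) (auto simp: p1_def)
        obtain u v where uv: "K = {u..v}" "u \<le> x" "x \<le> v" "a \<le> u" "v \<le> b" "K \<subseteq> G x"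
          using ival[OF xK(2)] by blast
        then have "x \<in> {a..b} - N" using xK by auto
        moreover have "\<bar>y - x\<bar> < r x" if "y \<in> {u, v}" for y
        proof -
          have "y \<in> G x" using that uv by auto
          then show ?thesis using xK uv by (auto simp: G_def dist_real_def)
        qed
        ultimately have "\<bar>g y - g x - f x * (y - x)\<bar> \<le> c * \<bar>y - x\<bar>" if "y \<in> {u, v}" for y
          using that uv by (intro r(2)) auto
        then have "\<bar>(v - u) * f x - (g v - g u)\<bar> \<le> c * (v - u)"
          using uv by (intro straddle_bound)
        then show "\<bar>err xK\<bar> \<le> c * measure lborel (snd xK)"
          using uv xK by (simp add: err_def)
      qed
      also have "\<dots> \<le> (\<Sum>xK\<in>p. c * measure lborel (snd xK))"
        using fin \<open>c > 0\<close> by (intro sum_mono2) auto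
      also have "\<dots> = c * (b - a)"
        using additive_content_tagged_division[OF p(1)] \<open>a \<le> b\<close>
        by (simp add: case_prod_unfold flip: sum_distrib_left)
      finally have 1: "\<bar>sum err (p - p1)\<bar> < e / 2"
        using \<open>c * (b - a) < e / 2\<close> by linarith
      have "p1 tagged_partial_division_of cbox a b"
        using p(1) fin by (meson tagged_division_of_def tagged_partial_division_subset)
      then have p1: "p1 tagged_division_of \<Union>(snd ` p1)"
        by (rule tagged_partial_division_of_Union_self)
      \<comment> \<open>An interval carried by two tags has empty interior and hence content 0, so
        the sum over tagged pieces equals the sum over the intervals themselves.\<close>
      have "(\<Sum>xK\<in>p1. measure lborel (snd xK)) = (\<Sum>K\<in>snd ` p1. measure lborel K)"
        using sum.over_tagged_division_lemma[OF p1, of "measure lborel"]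
        by (simp add: case_prod_unfold content_eq_0_interior)
      also have "\<dots> = measure lebesgue (\<Union>(snd ` p1))"
      proof -
        have "measure lborel K = measure lebesgue K" if "K \<in> snd ` p1" for K
          using division_ofD(4)[OF division_of_tagged_division[OF p1] that] by auto
        then show ?thesis
          using content_division[OF division_of_tagged_division[OF p1]] by simp
      qed
      also have "\<dots> < \<delta>"
      proof -
        have "\<Union>(snd ` p1) \<subseteq> U"
          using ival by (fastforce simp: p1_def G_def)
        then have "emeasure lebesgue (\<Union>(snd ` p1)) \<le> emeasure lebesgue U"
          using U(1) by (intro emeasure_mono) (auto simp: borel_open)
        also have "\<dots> < ennreal \<delta>" by fact
        finally show ?thesis
          unfolding measure_def
          by (cases "emeasure lebesgue (\<Union>(snd ` p1))") (simp_all add: ennreal_less_iff)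
      qed
      finally have small: "(\<Sum>xK\<in>p1. measure lborel (snd xK)) < \<delta>" .
      have "(\<Sum>xK\<in>p1. \<bar>g (Sup (snd xK)) - g (Inf (snd xK))\<bar>) < e / 2"
      proof (intro \<delta>[rule_format] conjI ballI impI fin(2))
        show "a \<le> Inf (snd xK)" "Inf (snd xK) \<le> Sup (snd xK)" "Sup (snd xK) \<le> b" if "xK \<in> p1" for xK
          using ival[of "fst xK" "snd xK"] that by (auto simp: p1_def)
        show "(\<Sum>xK\<in>p1. Sup (snd xK) - Inf (snd xK)) < \<delta>"
        proof -
          have "(\<Sum>xK\<in>p1. Sup (snd xK) - Inf (snd xK)) = (\<Sum>xK\<in>p1. measure lborel (snd xK))"
            using ival by (intro sum.cong) (fastforce simp: p1_def)+
          then show ?thesis using small by simp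
        qed
        show "{Inf (snd i)<..<Sup (snd i)} \<inter> {Inf (snd j)<..<Sup (snd j)} = {}" if ij: "i \<in> p1" "j \<in> p1" "i \<noteq> j" for i j
        proof -
          obtain x K x' K' where xK: "i = (x, K)" "j = (x', K')" by (cases i, cases j)
          then have in_p: "(x, K) \<in> p" "(x', K') \<in> p" "(x, K) \<noteq> (x', K')"
            using ij by (auto simp: p1_def)
          from ival[OF in_p(1)] obtain u v where "K = {u..v}" "u \<le> v" by (auto intro: order_trans)
          moreover from ival[OF in_p(2)] obtain u' v' where "K' = {u'..v'}" "u' \<le> v'"
            by (auto intro: order_trans)
          ultimately show ?thesis using P(5)[OF in_p] xK by simp
        qed
      qed
      moreover have "\<bar>sum err p1\<bar> \<le> (\<Sum>xK\<in>p1. \<bar>g (Sup (snd xK)) - g (Inf (snd xK))\<bar>)"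
        by (rule order_trans[OF sum_abs sum_mono]) (auto simp: err_def p1_def f_def increment_def)
      ultimately show ?thesis
        using 1 split by simp
    qed
    ultimately show "\<exists>G. gauge G \<and> (\<forall>p. p tagged_division_of cbox a b \<and> G fine p \<longrightarrow>
        norm ((\<Sum>(x, K)\<in>p. measure lborel K *\<^sub>R f x) - (g b - g a)) < e)"
      by (intro exI[of _ G] conjI[of "gauge G"] allI impI)
  qed
  then have "(f has_integral (g b - g a)) {a..b}" by simp
  then show ?thesis
    by (rule has_integral_spike[OF N, rotated]) (simp add: f_def)
qed

section \<open>Consequences for curves: composition, closed curves, measurability of the
  derivative\<close>

lemma absolutely_continuous_imp_continuous_on:
  assumes ac: "absolutely_continuous_curve a b g"
  shows "continuous_on {a..b} g"
  unfolding continuous_on_iff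
proof (intro ballI allI impI)
  fix x e :: real assume x: "x \<in> {a..b}" and "e > 0"
  obtain \<delta> where "\<delta> > 0" and \<delta>: "\<forall>(A :: unit set) u v. finite A \<and>
       (\<forall>i\<in>A. a \<le> u i \<and> u i \<le> v i \<and> v i \<le> b) \<and>
       (\<forall>i\<in>A. \<forall>j\<in>A. i \<noteq> j \<longrightarrow> {u i<..<v i} \<inter> {u j<..<v j} = {}) \<and>
       (\<Sum>i\<in>A. v i - u i) < \<delta> \<longrightarrow> (\<Sum>i\<in>A. \<bar>g (v i) - g (u i)\<bar>) < e"
    using absolutely_continuous_curve_finite_family[OF ac \<open>e > 0\<close>] by blast
  have "dist (g y) (g x) < e" if "y \<in> {a..b}" "dist y x < \<delta>" for y
    using \<delta>[rule_format, of "{()}" "\<lambda>_. min x y" "\<lambda>_. max x y"] x that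
    by (cases "x \<le> y") (simp_all add: dist_real_def min_def max_def)
  then show "\<exists>\<delta>>0. \<forall>y\<in>{a..b}. dist y x < \<delta> \<longrightarrow> dist (g y) (g x) < e"
    using \<open>\<delta> > 0\<close> by blast
qed

lemma absolutely_continuous_lipschitz_compose:
  assumes ac: "absolutely_continuous_curve a b \<eta>"
    and S: "\<eta> ` {a..b} \<subseteq> S"
    and lip: "\<And>x y. x \<in> S \<Longrightarrow> y \<in> S \<Longrightarrow> \<bar>P x - P y\<bar> \<le> C * \<bar>x - y\<bar>"
  shows "absolutely_continuous_curve a b (\<lambda>x. P (\<eta> x))"
  unfolding absolutely_continuous_curve_def
proof (intro allI impI)
  fix e :: real assume "e > 0"
  define C' where "C' = \<bar>C\<bar> + 1"
  have "C' > 0" "C \<le> C'" by (auto simp: C'_def)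
  then have "e / C' > 0" using \<open>e > 0\<close> by simp
  from ac[unfolded absolutely_continuous_curve_def, THEN spec, THEN mp, OF this]
  obtain \<delta> where "\<delta> > 0" and \<delta>: "\<forall>(n::nat) u v. (\<forall>i<n. a \<le> u i \<and> u i \<le> v i \<and> v i \<le> b) \<and>
        (\<forall>i<n. \<forall>j<n. i \<noteq> j \<longrightarrow> {u i<..<v i} \<inter> {u j<..<v j} = {}) \<and>
        (\<Sum>i<n. v i - u i) < \<delta> \<longrightarrow> (\<Sum>i<n. \<bar>\<eta> (v i) - \<eta> (u i)\<bar>) < e / C'"
    by (elim exE conjE) (rule that)
  show "\<exists>\<delta>>0. \<forall>(n::nat) u v. (\<forall>i<n. a \<le> u i \<and> u i \<le> v i \<and> v i \<le> b) \<and>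
        (\<forall>i<n. \<forall>j<n. i \<noteq> j \<longrightarrow> {u i<..<v i} \<inter> {u j<..<v j} = {}) \<and>
        (\<Sum>i<n. v i - u i) < \<delta> \<longrightarrow> (\<Sum>i<n. \<bar>P (\<eta> (v i)) - P (\<eta> (u i))\<bar>) < e"
  proof (intro exI[of _ \<delta>] conjI allI impI)
    fix n :: nat and u v
    assume uv: "(\<forall>i<n. a \<le> u i \<and> u i \<le> v i \<and> v i \<le> b) \<and>
        (\<forall>i<n. \<forall>j<n. i \<noteq> j \<longrightarrow> {u i<..<v i} \<inter> {u j<..<v j} = {}) \<and> (\<Sum>i<n. v i - u i) < \<delta>"
    have "(\<Sum>i<n. \<bar>P (\<eta> (v i)) - P (\<eta> (u i))\<bar>) \<le> (\<Sum>i<n. C' * \<bar>\<eta> (v i) - \<eta> (u i)\<bar>)"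
    proof (rule sum_mono)
      fix i assume "i \<in> {..<n}"
      then have "a \<le> u i" "u i \<le> v i" "v i \<le> b" using uv by auto
      then have "\<eta> (v i) \<in> S" "\<eta> (u i) \<in> S" using S by auto
      then have "\<bar>P (\<eta> (v i)) - P (\<eta> (u i))\<bar> \<le> C * \<bar>\<eta> (v i) - \<eta> (u i)\<bar>" by (rule lip)
      also have "\<dots> \<le> C' * \<bar>\<eta> (v i) - \<eta> (u i)\<bar>" using \<open>C \<le> C'\<close> by (rule mult_right_mono) simp
      finally show "\<bar>P (\<eta> (v i)) - P (\<eta> (u i))\<bar> \<le> C' * \<bar>\<eta> (v i) - \<eta> (u i)\<bar>" .
    qed
    also have "\<dots> = C' * (\<Sum>i<n. \<bar>\<eta> (v i) - \<eta> (u i)\<bar>)" by (simp add: sum_distrib_left)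
    also have "\<dots> < C' * (e / C')"
      using \<delta> uv \<open>C' > 0\<close> by (intro mult_strict_left_mono) blast+
    also have "\<dots> = e" using \<open>C' > 0\<close> by simp
    finally show "(\<Sum>i<n. \<bar>P (\<eta> (v i)) - P (\<eta> (u i))\<bar>) < e" .
  qed (rule \<open>\<delta> > 0\<close>)
qed

text \<open>\<open>deriv\<close> is two-sided and the values of \<open>\<eta>\<close> outside
  \<open>{a..b}\<close> are arbitrary, so the endpoints go into the exceptional set as well.\<close>

lemma absolutely_continuous_DERIV_deriv:
  assumes "absolutely_continuous_curve a b \<eta>"
  obtains N where "negligible N" "\<And>x. x \<in> {a..b} - N \<Longrightarrow> x \<in> {a<..<b} \<and> (\<eta> has_real_derivative deriv \<eta> x) (at x)"
proof
  let ?N = "{x \<in> {a<..<b}. \<nexists>D. (\<eta> has_real_derivative D) (at x)} \<union> {a, b}"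
  show "negligible ?N"
    by (intro negligible_Un absolutely_continuous_differentiable_ae[OF assms]) simp
  show "x \<in> {a<..<b} \<and> (\<eta> has_real_derivative deriv \<eta> x) (at x)" if "x \<in> {a..b} - ?N" for x
    using that by (auto dest: DERIV_imp_deriv)
qed

lemma integral_closed_curve_eq_0:
  fixes p :: "real \<Rightarrow> real"
  assumes "a \<le> b" and ac: "absolutely_continuous_curve a b \<eta>"
    and S: "\<eta> ` {a..b} \<subseteq> {s..t}" and p: "continuous_on UNIV p"
    and closed: "\<eta> a = \<eta> b"
  shows "((\<lambda>\<tau>. p (\<eta> \<tau>) * deriv \<eta> \<tau>) has_integral 0) {a..b}"
proof -
  \<comment> \<open>Integrating from \<open>s - 1\<close>, with \<open>x\<close> allowed up to
    \<open>t + 1\<close>, puts \<open>{s..t}\<close> in the interior of the domain, so that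
    \<open>P\<close> has a two-sided derivative also at \<open>s\<close> and
    \<open>t\<close>.\<close>
  define P where "P x = integral {s - 1..x} p" for x
  have P: "(P has_real_derivative p x) (at x)" if "x \<in> {s..t}" for x
  proof -
    have "(P has_real_derivative p x) (at x within {s - 1..t + 1})"
      unfolding P_def[abs_def] using that p
      by (intro integral_has_real_derivative continuous_on_subset[OF p]) auto
    then show ?thesis
      using that by (subst (asm) at_within_interior) (auto simp: interior_atLeastAtMost_real)
  qed
  \<comment> \<open>A bound for \<open>p\<close> is a Lipschitz constant for \<open>P\<close>, which
    carries absolute continuity from \<open>\<eta>\<close> to
    \<open>P \<circ> \<eta>\<close>.\<close>
  have "compact (p ` {s..t})"
    by (intro compact_continuous_image continuous_on_subset[OF p]) auto
  then obtain C where C: "\<And>x. x \<in> {s..t} \<Longrightarrow> norm (p x) \<le> C"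
    using compact_imp_bounded bounded_iff by (metis (no_types, lifting) imageI)
  have "\<bar>P x - P y\<bar> \<le> C * \<bar>x - y\<bar>" if "x \<in> {s..t}" "y \<in> {s..t}" for x y
    using field_differentiable_bound[of "{s..t}" P p C x y] that C P
    by (simp add: has_field_derivative_at_within)
  from absolutely_continuous_lipschitz_compose[OF ac S this]
  have acP: "absolutely_continuous_curve a b (\<lambda>x. P (\<eta> x))" .
  obtain N where N: "negligible N"
    "\<And>x. x \<in> {a..b} - N \<Longrightarrow> x \<in> {a<..<b} \<and> (\<eta> has_real_derivative deriv \<eta> x) (at x)"
    using absolutely_continuous_DERIV_deriv[OF ac] by metis
  have "((\<lambda>\<tau>. p (\<eta> \<tau>) * deriv \<eta> \<tau>) has_integral P (\<eta> b) - P (\<eta> a)) {a..b}"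
  proof (rule absolutely_continuous_fundamental_theorem[OF \<open>a \<le> b\<close> acP N(1)])
    fix x assume x: "x \<in> {a..b} - N"
    then have "\<eta> x \<in> {s..t}" using S by blast
    then have "(P has_real_derivative p (\<eta> x)) (at (\<eta> x))" by (rule P)
    moreover have "(\<eta> has_real_derivative deriv \<eta> x) (at x within {a..b})"
      using N(2)[OF x] by (simp add: has_field_derivative_at_within)
    ultimately show "((\<lambda>x. P (\<eta> x)) has_real_derivative p (\<eta> x) * deriv \<eta> x) (at x within {a..b})"
      by (rule DERIV_chain2[where f = P and g = \<eta>])
  qed
  then show ?thesis using closed by simp
qed

text \<open>By the fundamental theorem \<open>deriv \<eta>\<close> is Henstock-Kurzweil integrable,
  and such functions are Lebesgue measurable.\<close>

lemma borel_measurable_deriv_absolutely_continuous: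
  assumes "a \<le> b" "absolutely_continuous_curve a b \<eta>"
  shows "deriv \<eta> \<in> borel_measurable (lebesgue_on {a..b})"
proof -
  obtain N where N: "negligible N"
    "\<And>x. x \<in> {a..b} - N \<Longrightarrow> x \<in> {a<..<b} \<and> (\<eta> has_real_derivative deriv \<eta> x) (at x)"
    using absolutely_continuous_DERIV_deriv[OF assms(2)] by metis
  have "(deriv \<eta> has_integral \<eta> b - \<eta> a) {a..b}"
    using N by (intro absolutely_continuous_fundamental_theorem[OF assms N(1)])
      (blast intro: has_field_derivative_at_within)
  then show ?thesis
    by (intro integrable_imp_measurable) (auto simp: integrable_on_def)
qed

lemma deriv_eq_0_at_extremal_value:
  fixes \<eta> :: "real \<Rightarrow> real"
  assumes x: "x \<in> {a<..<b}" and S: "\<eta> ` {a..b} \<subseteq> {s..t}" and "\<eta> x \<in> {s, t}"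
    and D: "(\<eta> has_real_derivative D) (at x)"
  shows "D = 0"
proof -
  have r: "min (x - a) (b - x) > 0" using x by auto
  have nb: "\<eta> y \<in> {s..t}" if "\<bar>x - y\<bar> < min (x - a) (b - x)" for y
    using that S by (intro subsetD[OF S imageI]) auto
  show ?thesis
    using \<open>\<eta> x \<in> {s, t}\<close> DERIV_local_min[OF D r] DERIV_local_max[OF D r] nb by auto
qed

section \<open>Superlinear convex Hamiltonians\<close>

text \<open>The retraction of the line onto the unit interval. Hamiltonians are assumed continuous
  for positions in \<open>{0..1}\<close>; precomposing with the retraction gives functions that are
  continuous, hence Borel, on the whole line.\<close>

definition clamp01 :: "real \<Rightarrow> real" where "clamp01 s = max 0 (min 1 s)"

lemma clamp01_mem [simp]: "clamp01 s \<in> {0..1}"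
  and clamp01_id [simp]: "s \<in> {0..1} \<Longrightarrow> clamp01 s = s"
  by (auto simp: clamp01_def)

locale superlinear_hamiltonian =
  fixes h :: "real \<Rightarrow> real \<Rightarrow> real"
  assumes h_continuous: "continuous_on ({0..1} \<times> UNIV) (\<lambda>(s, \<mu>). h s \<mu>)"
    and h_convex: "s \<in> {0..1} \<Longrightarrow> convex_on UNIV (h s)"
    and h_superlinear: "filterlim (\<lambda>\<mu>. INF s\<in>{0..1}. h s \<mu> / \<bar>\<mu>\<bar>) at_top at_infinity"
begin

lemma continuous_position: "continuous_on UNIV (\<lambda>s. h (clamp01 s) \<mu>)"
proof -
  have "continuous_on UNIV ((\<lambda>(s, \<mu>). h s \<mu>) \<circ> (\<lambda>s. (clamp01 s, \<mu>)))"
    using clamp01_mem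
    by (intro continuous_on_compose continuous_on_subset[OF h_continuous])
      (auto simp: clamp01_def intro!: continuous_intros)
  then show ?thesis by (simp add: o_def)
qed

lemma continuous_momentum:
  assumes "s \<in> {0..1}"
  shows "continuous_on UNIV (h s)"
proof -
  have "continuous_on UNIV ((\<lambda>(s, \<mu>). h s \<mu>) \<circ> (\<lambda>\<mu>. (s, \<mu>)))"
    using assms
    by (intro continuous_on_compose continuous_on_subset[OF h_continuous])
      (auto intro!: continuous_intros)
  then show ?thesis by (simp add: o_def)
qed

lemma position_bounds:
  "\<exists>M. \<forall>s\<in>{0..1}. \<bar>h s \<mu>\<bar> \<le> M"
proof -
  have "compact ((\<lambda>s. h (clamp01 s) \<mu>) ` {0..1})"
    by (intro compact_continuous_image continuous_on_subset[OF continuous_position]) auto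
  then obtain M where "\<forall>s\<in>{0..1}. norm (h (clamp01 s) \<mu>) \<le> M"
    using compact_imp_bounded bounded_iff by (metis (no_types, lifting) imageI)
  then show ?thesis by (intro exI[of _ M]) auto
qed

text \<open>The supremum defining \<open>lagrangian\<close> is taken in the reals and is informative
  only once it is bounded. Superlinearity with slope \<open>\<bar>l\<bar>\<close> gives
  \<open>l * \<mu> \<le> h s \<mu>\<close> for large momenta; the remaining ones form a compact
  interval.\<close>

lemma lagrangian_bdd_above:
  assumes s: "s \<in> {0..1}"
  shows "bdd_above (range (\<lambda>\<mu>. l * \<mu> - h s \<mu>))"
proof -
  have "\<forall>\<^sub>F \<mu> in at_infinity. \<bar>l\<bar> \<le> (INF s\<in>{0..1}. h s \<mu> / \<bar>\<mu>\<bar>)"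
    using h_superlinear unfolding filterlim_at_top by blast
  then obtain R where R: "\<And>\<mu>. R \<le> norm \<mu> \<Longrightarrow> \<bar>l\<bar> \<le> (INF s\<in>{0..1}. h s \<mu> / \<bar>\<mu>\<bar>)"
    unfolding eventually_at_infinity by blast
  have "compact ((\<lambda>\<mu>. l * \<mu> - h s \<mu>) ` {-\<bar>R\<bar>..\<bar>R\<bar>})"
    by (intro compact_continuous_image continuous_intros continuous_on_subset[OF continuous_momentum[OF s]]) auto
  then have "bdd_above ((\<lambda>\<mu>. l * \<mu> - h s \<mu>) ` {-\<bar>R\<bar>..\<bar>R\<bar>})"
    by (intro bounded_imp_bdd_above compact_imp_bounded)
  then obtain M where M: "\<And>\<mu>. \<mu> \<in> {-\<bar>R\<bar>..\<bar>R\<bar>} \<Longrightarrow> l * \<mu> - h s \<mu> \<le> M"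
    unfolding bdd_above_def by blast
  have "l * \<mu> - h s \<mu> \<le> max M 0" for \<mu>
  proof (cases "\<bar>\<mu>\<bar> \<le> \<bar>R\<bar>")
    case True
    then show ?thesis using M[of \<mu>] by (auto simp: abs_le_iff)
  next
    case False
    then have "\<mu> \<noteq> 0" "R \<le> norm \<mu>" by auto
    obtain C where C: "\<And>s. s \<in> {0..1} \<Longrightarrow> \<bar>h s \<mu>\<bar> \<le> C"
      using position_bounds by blast
    have "bdd_below ((\<lambda>s. h s \<mu> / \<bar>\<mu>\<bar>) ` {0..1})"
    proof (rule bdd_belowI2)
      show "- C / \<bar>\<mu>\<bar> \<le> h x \<mu> / \<bar>\<mu>\<bar>" if "x \<in> {0..1}" for x
        using C[OF that] by (intro divide_right_mono) auto
    qed
    then have "(INF s\<in>{0..1}. h s \<mu> / \<bar>\<mu>\<bar>) \<le> h s \<mu> / \<bar>\<mu>\<bar>"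
      using s by (rule cINF_lower)
    then have "\<bar>l\<bar> \<le> h s \<mu> / \<bar>\<mu>\<bar>"
      using R[OF \<open>R \<le> norm \<mu>\<close>] by linarith
    then have "\<bar>l * \<mu>\<bar> \<le> h s \<mu>"
      using \<open>\<mu> \<noteq> 0\<close> by (simp add: le_divide_eq abs_mult)
    then show ?thesis by linarith
  qed
  then show ?thesis by (intro bdd_aboveI2[of _ _ "max M 0"]) auto
qed

lemma lagrangian_ge:
  assumes "s \<in> {0..1}"
  shows "l * \<mu> - h s \<mu> \<le> lagrangian h s l"
  unfolding lagrangian_def using lagrangian_bdd_above[OF assms] by (rule cSUP_upper[OF UNIV_I])

text \<open>Countable suprema preserve measurability, uncountable ones need not. The momenta at
  which \<open>l * \<mu> - h s \<mu>\<close> is at most the rational supremum form a closed set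
  containing the rationals, hence the whole line.\<close>

lemma lagrangian_eq_SUP_Rats:
  assumes s: "s \<in> {0..1}"
  shows "lagrangian h s l = (SUP \<mu>\<in>\<rat>. l * \<mu> - h s \<mu>)"
proof (rule antisym)
  let ?f = "\<lambda>\<mu>. l * \<mu> - h s \<mu>"
  have bdd: "bdd_above (?f ` \<rat>)"
    using lagrangian_bdd_above[OF s] by (rule bdd_above_mono) auto
  show "(SUP \<mu>\<in>\<rat>. ?f \<mu>) \<le> lagrangian h s l"
    by (rule cSUP_least) (auto intro: lagrangian_ge[OF s] Rats_0)
  have "closed {\<mu>. ?f \<mu> \<le> (SUP \<mu>\<in>\<rat>. ?f \<mu>)}"
    by (intro closed_Collect_le continuous_intros continuous_momentum[OF s])
  moreover have "\<rat> \<subseteq> {\<mu>. ?f \<mu> \<le> (SUP \<mu>\<in>\<rat>. ?f \<mu>)}"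
    using cSUP_upper[OF _ bdd] by blast
  ultimately have "closure \<rat> \<subseteq> {\<mu>. ?f \<mu> \<le> (SUP \<mu>\<in>\<rat>. ?f \<mu>)}"
    by (rule closure_minimal[rotated])
  then have "?f \<mu> \<le> (SUP \<mu>\<in>\<rat>. ?f \<mu>)" for \<mu>
    unfolding Rats_closure_real by blast
  then show "lagrangian h s l \<le> (SUP \<mu>\<in>\<rat>. ?f \<mu>)"
    unfolding lagrangian_def by (intro cSUP_least) auto
qed

lemma borel_measurable_lagrangian:
  assumes [measurable]: "\<eta> \<in> borel_measurable M" "\<xi> \<in> borel_measurable M"
    and \<eta>: "\<And>x. x \<in> space M \<Longrightarrow> \<eta> x \<in> {0..1}"
  shows "(\<lambda>x. lagrangian h (\<eta> x) (\<xi> x)) \<in> borel_measurable M"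
proof -
  have [measurable]: "(\<lambda>s. h (clamp01 s) \<mu>) \<in> borel_measurable borel" for \<mu>
    by (rule borel_measurable_continuous_onI[OF continuous_position])
  have "(\<lambda>x. SUP \<mu>\<in>\<rat>. \<xi> x * \<mu> - h (clamp01 (\<eta> x)) \<mu>) \<in> borel_measurable M"
  proof (rule borel_measurable_cSUP)
    show "(\<lambda>x. \<xi> x * \<mu> - h (clamp01 (\<eta> x)) \<mu>) \<in> borel_measurable M" for \<mu>
      by measurable
    show "bdd_above ((\<lambda>\<mu>. \<xi> x * \<mu> - h (clamp01 (\<eta> x)) \<mu>) ` \<rat>)" for x
      using lagrangian_bdd_above[OF clamp01_mem] by (rule bdd_above_mono) auto
  qed (rule countable_rat)
  then show ?thesis
    by (rule measurable_cong[THEN iffD1, rotated]) (use \<eta> in \<open>simp add: lagrangian_eq_SUP_Rats\<close>)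
qed

text \<open>\<open>- arc_constant h\<close> is the largest of the minimal values of
  \<open>h s\<close>, so \<open>h s\<close> has infimum at most \<open>- m\<close>. The inequality
  is strict so that it survives small changes of \<open>s\<close>.\<close>

lemma subsolution_pointwise:
  assumes m: "m \<le> arc_constant h" and s: "s \<in> {0..1}" and "e > 0"
  shows "\<exists>\<mu>. h s \<mu> < - m + e"
proof -
  \<comment> \<open>At \<open>l = 0\<close> the Lagrangian is minus the infimum of
    \<open>h s\<close>, so its finiteness bounds \<open>h s\<close> below.\<close>
  have bdd: "bdd_below (range (h s))" if "s \<in> {0..1}" for s
    using lagrangian_ge[OF that, of 0] by (intro bdd_belowI2[of _ "- lagrangian h s 0"]) (simp add: minus_le_iff)
  obtain M where M: "\<And>s. s \<in> {0..1} \<Longrightarrow> \<bar>h s 0\<bar> \<le> M"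
    using position_bounds by blast
  have "(INF \<mu>. h x \<mu>) \<le> M" if "x \<in> {0..1}" for x
    using cINF_lower[OF bdd[OF that] UNIV_I, of 0] M[OF that] by linarith
  then have "bdd_above ((\<lambda>s. INF \<mu>. h s \<mu>) ` {0..1})"
    by (rule bdd_aboveI2)
  then have "(INF \<mu>. h s \<mu>) \<le> - arc_constant h"
    unfolding arc_constant_def minus_minus by (rule cSUP_upper[OF s])
  also have "\<dots> < - m + e" using m \<open>e > 0\<close> by simp
  finally show ?thesis
    by (subst (asm) cINF_less_iff) (auto intro: bdd[OF s])
qed

text \<open>Minus the infimum of \<open>h s\<close> is \<open>lagrangian h s 0\<close>. In
  consequence the correction made to the Lagrangian at the endpoints of the arc is never
  positive.\<close>

lemma arc_constant_le_lagrangian: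
  assumes "m \<le> arc_constant h" "s \<in> {0..1}"
  shows "m \<le> lagrangian h s 0"
proof (rule field_le_epsilon)
  fix e :: real assume "e > 0"
  then obtain \<mu> where "h s \<mu> < - m + e" using subsolution_pointwise assms by blast
  then show "m \<le> lagrangian h s 0 + e"
    using lagrangian_ge[OF assms(2), of 0 \<mu>] by simp
qed

lemma continuous_subsolution:
  assumes m: "m \<le> arc_constant h" and "e > 0"
  obtains p where "continuous_on UNIV p" "\<And>s. s \<in> {0..1} \<Longrightarrow> h s (p s) \<le> - m + e"
proof -
  txt \<open>The weights vanish unless \<open>h s \<mu> < - m + e\<close>, so convexity bounds \<open>h\<close> at the weighted mean.\<close>
  define w where "w \<mu> s = max 0 (- m + e - h (clamp01 s) \<mu>)" for \<mu> s
  have cont: "continuous_on UNIV (w \<mu>)" for \<mu>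
    unfolding w_def[abs_def] by (intro continuous_intros continuous_position)
  \<comment> \<open>A momentum that is a strict subsolution at \<open>s\<close> stays one nearby, so
    by compactness finitely many momenta serve the whole unit interval.\<close>
  have "{0..1::real} \<subseteq> (\<Union>\<mu>. {s. 0 < w \<mu> s})"
  proof
    fix s :: real assume "s \<in> {0..1}"
    then obtain \<mu> where "h s \<mu> < - m + e" using subsolution_pointwise m \<open>e > 0\<close> by blast
    then have "0 < w \<mu> s" using \<open>s \<in> {0..1}\<close> by (simp add: w_def del: atLeastAtMost_iff)
    then show "s \<in> (\<Union>\<mu>. {s. 0 < w \<mu> s})" by blast
  qed
  moreover have "open {s. 0 < w \<mu> s}" for \<mu>
    by (intro open_Collect_less continuous_intros cont)
  ultimately obtain D where D: "finite D" "{0..1::real} \<subseteq> (\<Union>\<mu>\<in>D. {s. 0 < w \<mu> s})"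
    using compactE_image[of "{0..1::real}" UNIV "\<lambda>\<mu>. {s. 0 < w \<mu> s}"] by (metis compact_Icc)
  define W where "W s = (\<Sum>\<mu>\<in>D. w \<mu> s)" for s
  \<comment> \<open>\<open>w\<close> sees its position only through the clamp, so \<open>W\<close>
    is positive on the whole line and \<open>p\<close> is continuous there.\<close>
  have W: "W s > 0" for s
  proof -
    obtain \<mu> where "\<mu> \<in> D" "0 < w \<mu> (clamp01 s)"
      using D(2) clamp01_mem[of s] by blast
    moreover have "w \<mu> (clamp01 s) = w \<mu> s"
      using clamp01_id[OF clamp01_mem] by (simp add: w_def)
    ultimately show ?thesis
      unfolding W_def using D(1) by (intro sum_pos2[of D \<mu>]) (auto simp: w_def)
  qed
  define p where "p s = (\<Sum>\<mu>\<in>D. (w \<mu> s / W s) *\<^sub>R \<mu>)" for s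
  show thesis
  proof
    have "W s \<noteq> 0" for s using W[of s] by simp
    moreover have "continuous_on UNIV W"
      unfolding W_def[abs_def] by (intro continuous_intros cont)
    ultimately show "continuous_on UNIV p"
      unfolding p_def[abs_def] by (intro continuous_intros cont) auto
    fix s :: real assume s: "s \<in> {0..1}"
    have "h s (p s) \<le> (\<Sum>\<mu>\<in>D. w \<mu> s / W s * h s \<mu>)"
      unfolding p_def
    proof (rule convex_on_sum[OF D(1) _ h_convex[OF s]])
      show "D \<noteq> {}" using D(2) by auto
      show "(\<Sum>\<mu>\<in>D. w \<mu> s / W s) = 1"
        using W[of s] by (simp add: W_def flip: sum_divide_distrib)
      show "0 \<le> w \<mu> s / W s" for \<mu>
        using W[of s] by (simp add: w_def)
    qed auto
    also have "\<dots> \<le> (\<Sum>\<mu>\<in>D. w \<mu> s / W s * (- m + e))"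
    proof (rule sum_mono)
      fix \<mu>
      have "w \<mu> s * h s \<mu> \<le> w \<mu> s * (- m + e)"
        using s by (auto simp: w_def max_def simp del: atLeastAtMost_iff intro!: mult_left_mono)
      then show "w \<mu> s / W s * h s \<mu> \<le> w \<mu> s / W s * (- m + e)"
        using W[of s] by (simp add: divide_right_mono)
    qed
    also have "\<dots> = - m + e"
      using W[of s] by (simp add: W_def flip: sum_divide_distrib sum_distrib_right)
    finally show "h s (p s) \<le> - m + e" .
  qed
qed

end

section \<open>The action of closed curves\<close>

text \<open>The negative part of \<open>g\<close> is dominated by that of \<open>f\<close>, so both
  extended integrals are specified and no difference of two infinities occurs.\<close>

lemma extended_integral_mono:
  assumes [measurable]: "f \<in> borel_measurable M" "g \<in> borel_measurable M"
    and le: "\<And>x. x \<in> space M \<Longrightarrow> f x \<le> g x"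
    and fin: "(\<integral>\<^sup>+x. ennreal (- f x) \<partial>M) < \<infinity>"
  shows "extended_integral M f \<le> extended_integral M g"
proof -
  have pos: "(\<integral>\<^sup>+x. ennreal (f x) \<partial>M) \<le> (\<integral>\<^sup>+x. ennreal (g x) \<partial>M)"
    by (intro nn_integral_mono ennreal_leI le)
  have neg: "(\<integral>\<^sup>+x. ennreal (- g x) \<partial>M) \<le> (\<integral>\<^sup>+x. ennreal (- f x) \<partial>M)"
    by (intro nn_integral_mono ennreal_leI) (simp add: le)
  then have "(\<integral>\<^sup>+x. ennreal (- g x) \<partial>M) < \<infinity>" using fin by (rule order_le_less_trans)
  then show ?thesis
    using pos neg fin by (simp add: extended_integral_def ereal_minus_mono less_eq_ennreal.rep_eq)
qed

text \<open>If the positive part has infinite integral, the extended integral is infinite and the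
  bound trivial. Otherwise \<open>f\<close> is integrable, and only then is an estimate of its
  Bochner integral asked for.\<close>

lemma extended_integral_ge:
  assumes [measurable]: "f \<in> borel_measurable M"
    and fin: "(\<integral>\<^sup>+x. ennreal (- f x) \<partial>M) < \<infinity>"
    and le: "integrable M f \<Longrightarrow> B \<le> integral\<^sup>L M f"
  shows "ereal B \<le> extended_integral M f"
proof (cases "(\<integral>\<^sup>+x. ennreal (f x) \<partial>M) = \<infinity>")
  case True
  have "enn2ereal (\<integral>\<^sup>+x. ennreal (- f x) \<partial>M) \<noteq> \<infinity>"
    using fin by simp
  then show ?thesis
    using True fin by (simp add: extended_integral_def)
next
  case False
  then have int: "integrable M f"
    using fin by (simp add: real_integrable_def less_top)
  obtain u v where uv: "(\<integral>\<^sup>+x. ennreal (f x) \<partial>M) = ennreal u" "0 \<le> u"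
      "(\<integral>\<^sup>+x. ennreal (- f x) \<partial>M) = ennreal v" "0 \<le> v"
    using False fin by (metis ennreal_cases less_irrefl infinity_ennreal_def)
  then have "extended_integral M f = ereal (u - v)"
    by (simp add: extended_integral_def enn2ereal_ennreal)
  moreover have "integral\<^sup>L M f = u - v"
    using real_lebesgue_integral_def[OF int] uv by simp
  ultimately show ?thesis using le[OF int] by simp
qed

section \<open>The modified Lagrangian and its action\<close>

context superlinear_hamiltonian
begin

lemma modified_lagrangian_le:
  assumes "min (c (pathstart \<gamma>)) (c (pathfinish \<gamma>)) \<le> arc_constant h" "s \<in> {0..1}"
  shows "modified_lagrangian c \<gamma> h s l \<le> lagrangian h s l"
  using arc_constant_le_lagrangian[OF assms] by (simp add: modified_lagrangian_def)

text \<open>The momentum 0 gives \<open>lagrangian h s l \<ge> - h s 0\<close>, which is bounded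
  below on the unit interval, and the correction at the endpoints takes at most two values.\<close>

lemma modified_lagrangian_bdd_below:
  "\<exists>C. \<forall>s\<in>{0..1}. \<forall>l. C \<le> modified_lagrangian c \<gamma> h s l"
proof -
  obtain M where M: "\<forall>s\<in>{0..1}. \<bar>h s 0\<bar> \<le> M"
    using position_bounds by blast
  define m where "m = min (c (pathstart \<gamma>)) (c (pathfinish \<gamma>))"
  define C where "C = - M - \<bar>m\<bar> - \<bar>lagrangian h 0 0\<bar> - \<bar>lagrangian h 1 0\<bar>"
  have "C \<le> modified_lagrangian c \<gamma> h s l" if s: "s \<in> {0..1}" for s l
  proof -
    have "- M \<le> lagrangian h s l"
      using lagrangian_ge[OF s, of l 0] bspec[OF M s] by linarith
    then show ?thesis
      unfolding modified_lagrangian_def m_def[symmetric] C_def by auto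
  qed
  then show ?thesis by blast
qed

lemma borel_measurable_modified_lagrangian:
  assumes [measurable]: "\<eta> \<in> borel_measurable M" "\<xi> \<in> borel_measurable M"
    and \<eta>: "\<And>x. x \<in> space M \<Longrightarrow> \<eta> x \<in> {0..1}"
  shows "(\<lambda>x. modified_lagrangian c \<gamma> h (\<eta> x) (\<xi> x)) \<in> borel_measurable M"
proof -
  have [measurable]: "(\<lambda>x. lagrangian h (\<eta> x) (\<xi> x)) \<in> borel_measurable M"
    "(\<lambda>x. lagrangian h (\<eta> x) 0) \<in> borel_measurable M"
    by (intro borel_measurable_lagrangian assms borel_measurable_const; assumption)+
  have "(\<lambda>x. if \<eta> x = 0 \<or> \<eta> x = 1
      then lagrangian h (\<eta> x) (\<xi> x) + min (c (pathstart \<gamma>)) (c (pathfinish \<gamma>)) - lagrangian h (\<eta> x) 0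
      else lagrangian h (\<eta> x) (\<xi> x)) \<in> borel_measurable M"
    by measurable
  then show ?thesis by (simp add: modified_lagrangian_def)
qed

context
  fixes c :: "'a::topological_space \<Rightarrow> real" and \<gamma> :: "real \<Rightarrow> 'a" and a b m :: real and \<eta> :: "real \<Rightarrow> real"
  defines "m \<equiv> min (c (pathstart \<gamma>)) (c (pathfinish \<gamma>))"
  assumes m: "m \<le> arc_constant h"
    and ab: "a \<le> b"
    and ac: "absolutely_continuous_curve a b \<eta>"
    and S: "\<eta> ` {a..b} \<subseteq> {0..1}"
begin

lemma modified_action_closed_curve_ge:
  assumes closed: "\<eta> a = \<eta> b"
    and int: "integrable (lebesgue_on {a..b}) (\<lambda>\<tau>. modified_lagrangian c \<gamma> h (\<eta> \<tau>) (deriv \<eta> \<tau>))"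
  shows "m * (b - a) \<le> (LINT \<tau>|lebesgue_on {a..b}. modified_lagrangian c \<gamma> h (\<eta> \<tau>) (deriv \<eta> \<tau>))"
    (is "_ \<le> integral\<^sup>L _ ?f")
proof -
  have f: "(?f has_integral (integral\<^sup>L (lebesgue_on {a..b}) ?f)) {a..b}"
    by (rule has_integral_integral_lebesgue_on[OF int]) simp
  obtain N where N: "negligible N"
    "\<And>x. x \<in> {a..b} - N \<Longrightarrow> x \<in> {a<..<b} \<and> (\<eta> has_real_derivative deriv \<eta> x) (at x)"
    using absolutely_continuous_DERIV_deriv[OF ac] by metis
  have le: "(m - e) * (b - a) \<le> integral\<^sup>L (lebesgue_on {a..b}) ?f" if "e > 0" for e
  proof -
    from continuous_subsolution[OF m that]
    obtain p where p: "continuous_on UNIV p" "\<And>s. s \<in> {0..1} \<Longrightarrow> h s (p s) \<le> - m + e"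
      by blast
    let ?g = "\<lambda>\<tau>. p (\<eta> \<tau>) * deriv \<eta> \<tau> + (m - e)"
    have "(?g has_integral (0 + (b - a) *\<^sub>R (m - e))) {a..b}"
      using has_integral_const_real[of "m - e" a b] ab
      by (intro has_integral_add integral_closed_curve_eq_0[OF ab ac S p(1) closed]) simp
    \<comment> \<open>The comparison of integrals asks for the inequality at every time, so on the
      null set \<open>N\<close> the minorant is replaced by \<open>?f\<close> itself.\<close>
    then have "((\<lambda>\<tau>. if \<tau> \<in> N then ?f \<tau> else ?g \<tau>) has_integral (0 + (b - a) *\<^sub>R (m - e))) {a..b}"
      by (rule has_integral_spike[OF N(1), rotated]) simp
    then have "0 + (b - a) *\<^sub>R (m - e) \<le> integral\<^sup>L (lebesgue_on {a..b}) ?f"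
    proof (rule has_integral_le[OF _ f])
      fix \<tau> assume \<tau>: "\<tau> \<in> {a..b}"
      show "(if \<tau> \<in> N then ?f \<tau> else ?g \<tau>) \<le> ?f \<tau>"
      proof (cases "\<tau> \<in> N")
        case False
        have \<eta>: "\<eta> \<tau> \<in> {0..1}" using S \<tau> by blast
        have D: "\<tau> \<in> {a<..<b}" "(\<eta> has_real_derivative deriv \<eta> \<tau>) (at \<tau>)"
          using N(2) False \<tau> by blast+
        have "?g \<tau> \<le> ?f \<tau>"
        proof (cases "\<eta> \<tau> \<in> {0, 1}")
          case True
          then have "deriv \<eta> \<tau> = 0"
            using deriv_eq_0_at_extremal_value[OF D(1) S _ D(2)] by blast
          then show ?thesis
            using True \<open>e > 0\<close> by (auto simp: modified_lagrangian_def m_def)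
        next
          case False
          then show ?thesis
            using lagrangian_ge[OF \<eta>, of "deriv \<eta> \<tau>" "p (\<eta> \<tau>)"] p(2)[OF \<eta>]
            by (simp add: modified_lagrangian_def mult.commute)
        qed
        then show ?thesis using False by simp
      qed simp
    qed
    then show ?thesis by (simp add: mult.commute)
  qed
  show ?thesis
  proof (rule field_le_epsilon)
    fix e :: real assume "e > 0"
    \<comment> \<open>Small enough for \<open>e' * (b - a) \<le> e\<close>, the added 1 covering
      \<open>a = b\<close>.\<close>
    define e' where "e' = e / (b - a + 1)"
    have "e' > 0" "e' * (b - a) \<le> e"
      using \<open>e > 0\<close> ab by (simp_all add: e'_def field_simps)
    then show "m * (b - a) \<le> integral\<^sup>L (lebesgue_on {a..b}) ?f + e"
      using le[of e'] by (simp add: algebra_simps)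
  qed
qed

lemma action_measurability:
  shows "(\<lambda>\<tau>. lagrangian h (\<eta> \<tau>) (deriv \<eta> \<tau>)) \<in> borel_measurable (lebesgue_on {a..b})"
    and "(\<lambda>\<tau>. modified_lagrangian c \<gamma> h (\<eta> \<tau>) (deriv \<eta> \<tau>)) \<in> borel_measurable (lebesgue_on {a..b})"
proof -
  have "\<eta> \<in> borel_measurable (lebesgue_on {a..b})"
    by (intro continuous_imp_measurable_on_sets_lebesgue absolutely_continuous_imp_continuous_on[OF ac]) simp
  moreover have "deriv \<eta> \<in> borel_measurable (lebesgue_on {a..b})"
    by (rule borel_measurable_deriv_absolutely_continuous[OF ab ac])
  moreover have "\<eta> x \<in> {0..1}" if "x \<in> space (lebesgue_on {a..b})" for x
    using that S unfolding space_lebesgue_on by blast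
  ultimately show "(\<lambda>\<tau>. lagrangian h (\<eta> \<tau>) (deriv \<eta> \<tau>)) \<in> borel_measurable (lebesgue_on {a..b})"
    "(\<lambda>\<tau>. modified_lagrangian c \<gamma> h (\<eta> \<tau>) (deriv \<eta> \<tau>)) \<in> borel_measurable (lebesgue_on {a..b})"
    using borel_measurable_lagrangian borel_measurable_modified_lagrangian by blast+
qed

lemma modified_action_neg_part_finite:
  "(\<integral>\<^sup>+\<tau>. ennreal (- modified_lagrangian c \<gamma> h (\<eta> \<tau>) (deriv \<eta> \<tau>)) \<partial>lebesgue_on {a..b}) < \<infinity>"
proof -
  obtain C where C: "\<forall>s\<in>{0..1}. \<forall>l. C \<le> modified_lagrangian c \<gamma> h s l"
    using modified_lagrangian_bdd_below by blast
  have "(\<integral>\<^sup>+\<tau>. ennreal (- modified_lagrangian c \<gamma> h (\<eta> \<tau>) (deriv \<eta> \<tau>)) \<partial>lebesgue_on {a..b})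
      \<le> (\<integral>\<^sup>+\<tau>. ennreal (- C) \<partial>lebesgue_on {a..b})"
    using C S by (intro nn_integral_mono ennreal_leI) (simp add: image_subset_iff)
  also have "\<dots> = ennreal (- C) * emeasure (lebesgue_on {a..b}) {a..b}"
    by (subst nn_integral_const) simp
  also have "\<dots> < \<infinity>"
    using ab by (simp add: emeasure_restrict_space ennreal_mult_less_top)
  finally show ?thesis .
qed

lemma action_modified_le: "action (modified_lagrangian c \<gamma> h) a b \<eta> \<le> action (lagrangian h) a b \<eta>"
  unfolding action_def
  using S m[unfolded m_def]
  by (intro extended_integral_mono action_measurability modified_action_neg_part_finite modified_lagrangian_le)
    (simp_all add: image_subset_iff)

lemma action_modified_ge:
  assumes "\<eta> a = \<eta> b"
  shows "ereal (m * (b - a)) \<le> action (modified_lagrangian c \<gamma> h) a b \<eta>"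
  unfolding action_def
  by (intro extended_integral_ge action_measurability modified_action_neg_part_finite
      modified_action_closed_curve_ge assms)

end

end

theorem proposition3p6:
  fixes E :: "(real \<Rightarrow> real ^ 'n) set"
    and H :: "(real \<Rightarrow> real ^ 'n) \<Rightarrow> real \<Rightarrow> real \<Rightarrow> real"
    and c :: "real ^ 'n \<Rightarrow> real"
    and \<gamma> :: "real \<Rightarrow> real ^ 'n"
    and \<eta> :: "real \<Rightarrow> real" and a b :: real
  assumes "flux_limited_network E H c"
    and "\<gamma> \<in> E"
    and "a \<le> b"
    and "absolutely_continuous_curve a b \<eta>"
    and "\<eta> ` {a..b} \<subseteq> {0..1}"
    and "\<eta> a = \<eta> b"
  shows "action (lagrangian (H \<gamma>)) a b \<eta> \<ge> action (modified_lagrangian c \<gamma> (H \<gamma>)) a b \<eta> \<and>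
         action (modified_lagrangian c \<gamma> (H \<gamma>)) a b \<eta>
           \<ge> ereal (min (c (\<gamma> 0)) (c (\<gamma> 1)) * (b - a))"
proof -
  interpret flux_limited_network E H c by fact
  interpret superlinear_hamiltonian "H \<gamma>"
    using H_continuous H_convex H_superlinear \<open>\<gamma> \<in> E\<close> by unfold_locales
  \<comment> \<open>\<open>\<gamma>\<close> is itself among the arcs ending at
    \<open>pathfinish \<gamma>\<close>, so the flux limiter there is at most the constant of
    \<open>\<gamma>\<close>, and the minimum over both ends is no larger.\<close>
  have "c (pathfinish \<gamma>) \<le> Min ((\<lambda>\<gamma>. arc_constant (H \<gamma>)) ` arcs_into E (pathfinish \<gamma>))"
    using \<open>\<gamma> \<in> E\<close> by (intro flux_limiter) (auto simp: vertices_def)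
  also have "\<dots> \<le> arc_constant (H \<gamma>)"
    using \<open>\<gamma> \<in> E\<close> finite_arcs by (intro Min_le) (auto simp: arcs_into_def)
  finally have "min (c (pathstart \<gamma>)) (c (pathfinish \<gamma>)) \<le> arc_constant (H \<gamma>)"
    by linarith
  from action_modified_le[OF this assms(3-5)] action_modified_ge[OF this assms(3-6)]
  show ?thesis by (simp add: pathstart_def pathfinish_def)
qed

end
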